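(* Let $\alpha\in(0,2)$ and consider three equal masses $m>0$ in the plane. Suppose $x=(x_0,x_1,x_2)\in\mathcal H_{\mathrm{eight}}$ is collision-free and is a critical point of $\mathcal F=K^{\frac{\alpha}{\alpha+2}}V^{\frac{2}{\alpha+2}}$ within $\mathcal H_{\mathrm{eight}}$, i.e. $D\mathcal F(x)[\eta]=0$ for every $\eta\in T_x\mathcal H_{\mathrm{eight}}$. Then $$m\,\ddot x_i(t)=\rho\,\nabla_{x_i}U(x(t)),\quad i=0,1,2,\qquad\text{with the constant } \rho=\frac{2K(x)}{\alpha V(x)}>0,$$ and, with the change of time variable $s=\sqrt{\rho}\,t$, the curve satisfies Newton's equation $m\,\frac{d^2x_i}{ds^2}=\nabla_{x_i}U(x(s))$, $i=0,1,2$.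
   Context: $\mathbb T:=\mathbb R/(2\pi\mathbb Z)$. For $x=(x_0,x_1,x_2):\mathbb T\to(\mathbb R^2)^3$ set $K(x)=\frac12\int_0^{2\pi}\sum_i m|\dot x_i|^2\,dt$, $U(x)=\sum_{i<j}m^2|x_i-x_j|^{-\alpha}$, $V(x)=\int_0^{2\pi}U(x(t))\,dt$. The class $\mathcal H_{\mathrm{eight}}$ consists of the choreographies $x_i(t)=\gamma(t+2\pi i/3)$, $i=0,1,2$, generated by loops $\gamma=(\gamma^1,\gamma^2)\in H^1(\mathbb T;\mathbb R^2)$ with $\gamma(0)=(0,0)$ and, for all $t$: (A$_x$) $\gamma(t+\pi)=(\gamma^1(t),-\gamma^2(t))$; (Y$^\star$) $\gamma(\tfrac{\pi}{2}+t)=\big(-\gamma^1(\tfrac{\pi}{2}-t),\,\gamma^2(\tfrac{\pi}{2}-t)\big)$. These conditions are linear and define a closed linear subspace of $H^1(\mathbb T;(\mathbb R^2)^3)$; $T_x\mathcal H_{\mathrm{eight}}$ is the space of $\eta\in H^1(\mathbb T;(\mathbb R^2)^3)$ satisfying the same symmetries and linear constraints. Collision-free means $x_i(t)\neq x_j(t)$ for all $t$ and $i\neq j$; on collision-free curves $K$ and $V$ are $C^1$. *)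

theory Defs
  imports "HOL-Analysis.Analysis"
begin

type_synonym plane = "real^2"

(* Configurations of three bodies. The index type 3 has the elements 0, 1, 2, with 0 < 1 < 2. *)
type_synonym config = "real^2^3"

(* Functions on the circle are 2*pi-periodic functions on the line. An element of
   H1 is represented by its absolutely continuous representative f, i.e. f is the
   integral of an L2 function g, its weak derivative. *)
definition has_weak_deriv :: "(real \<Rightarrow> 'a::euclidean_space) \<Rightarrow> (real \<Rightarrow> 'a) \<Rightarrow> bool" where
  "has_weak_deriv f g \<longleftrightarrow>
     set_integrable lborel {0..2*pi} g \<and>
     set_integrable lborel {0..2*pi} (\<lambda>t. (norm (g t))\<^sup>2) \<and>
     (\<forall>t\<in>{0..2*pi}. f t = f 0 + (LBINT s:{0..t}. g s))"

definition H1_loops :: "(real \<Rightarrow> 'a::euclidean_space) set" where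
  "H1_loops = {f. (\<forall>t. f (t + 2*pi) = f t) \<and> (\<exists>g. has_weak_deriv f g)}"

(* On [0, 2*pi] the weak derivative is unique up to a null set, so integrals over
   that interval do not depend on the choice. *)
definition weak_deriv :: "(real \<Rightarrow> 'a::euclidean_space) \<Rightarrow> real \<Rightarrow> 'a" where
  "weak_deriv f = (SOME g. has_weak_deriv f g)"

definition kinetic :: "real \<Rightarrow> (real \<Rightarrow> config) \<Rightarrow> real" where
  "kinetic m x = 1/2 * (LBINT t:{0..2*pi}. (\<Sum>i\<in>UNIV. m * (norm (weak_deriv x t $ i))\<^sup>2))"

definition potential :: "real \<Rightarrow> real \<Rightarrow> config \<Rightarrow> real" where
  "potential \<alpha> m q = (\<Sum>(i,j)\<in>{(i,j). i < j}. m\<^sup>2 * norm (q $ i - q $ j) powr (-\<alpha>))"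

definition potential_integral :: "real \<Rightarrow> real \<Rightarrow> (real \<Rightarrow> config) \<Rightarrow> real" where
  "potential_integral \<alpha> m x = (LBINT t:{0..2*pi}. potential \<alpha> m (x t))"

definition functional_F :: "real \<Rightarrow> real \<Rightarrow> (real \<Rightarrow> config) \<Rightarrow> real" where
  "functional_F \<alpha> m x =
     kinetic m x powr (\<alpha> / (\<alpha> + 2)) * potential_integral \<alpha> m x powr (2 / (\<alpha> + 2))"

definition eight_generators :: "(real \<Rightarrow> plane) set" where
  "eight_generators = {\<gamma>. \<gamma> \<in> H1_loops \<and> \<gamma> 0 = 0 \<and>
     (\<forall>t. \<gamma> (t + pi) $ 1 = \<gamma> t $ 1 \<and> \<gamma> (t + pi) $ 2 = - \<gamma> t $ 2) \<and>
     (\<forall>t. \<gamma> (pi/2 + t) $ 1 = - \<gamma> (pi/2 - t) $ 1 \<and> \<gamma> (pi/2 + t) $ 2 = \<gamma> (pi/2 - t) $ 2)}"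

definition H_eight :: "(real \<Rightarrow> config) set" where
  "H_eight = {x. \<exists>\<gamma>\<in>eight_generators. \<forall>t.
     x t $ 0 = \<gamma> t \<and> x t $ 1 = \<gamma> (t + 2*pi/3) \<and> x t $ 2 = \<gamma> (t + 4*pi/3)}"

definition collision_free :: "(real \<Rightarrow> config) \<Rightarrow> bool" where
  "collision_free x \<longleftrightarrow> (\<forall>t i j. i \<noteq> j \<longrightarrow> x t $ i \<noteq> x t $ j)"

(* H_eight is a linear space, hence equal to its tangent space at x. Since F is C1
   near collision-free curves, DF(x)[eta] is the derivative of F along x + e * eta. *)
definition critical_in_H_eight :: "real \<Rightarrow> real \<Rightarrow> (real \<Rightarrow> config) \<Rightarrow> bool" where
  "critical_in_H_eight \<alpha> m x \<longleftrightarrow>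
     (\<forall>\<eta>\<in>H_eight.
        ((\<lambda>e. functional_F \<alpha> m (\<lambda>t. x t + e *\<^sub>R \<eta> t)) has_real_derivative 0) (at 0))"

definition gradient :: "('a::real_inner \<Rightarrow> real) \<Rightarrow> 'a \<Rightarrow> 'a" where
  "gradient f p = (THE D. GDERIV f p :> D)"

lemma gradient_eq:
  assumes "GDERIV f p :> D"
  shows "gradient f p = D"
proof -
  have "D' = D" if "GDERIV f p :> D'" for D'
  proof -
    have "(\<lambda>h. h \<bullet> D') = (\<lambda>h. h \<bullet> D)"
      using that assms unfolding gderiv_def by (rule has_derivative_unique)
    then show ?thesis
      by (metis vector_eq_ldot)
  qed
  with assms show ?thesis
    unfolding gradient_def by (rule the_equality)
qed

definition body_gradient :: "real \<Rightarrow> real \<Rightarrow> 3 \<Rightarrow> config \<Rightarrow> plane" where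
  "body_gradient \<alpha> m i q =
     gradient (\<lambda>y. potential \<alpha> m (\<chi> k. if k = i then y else q $ k)) (q $ i)"

definition has_second_deriv :: "(real \<Rightarrow> 'a::real_normed_vector) \<Rightarrow> (real \<Rightarrow> 'a) \<Rightarrow> bool" where
  "has_second_deriv f a \<longleftrightarrow>
     (\<exists>v. \<forall>t. (f has_vector_derivative v t) (at t) \<and> (v has_vector_derivative a t) (at t))"

end

(* The symmetries of the eight-shaped generators amount to gamma being odd and gamma (t + pi)
   being the reflection of gamma t. The force Phi along the choreography inherits them, so it has
   a C2 second antiderivative q in the same symmetry class, and h = m gamma - rho q generates an
   admissible variation. Integrating Phi by parts, the first variation in the direction of h is
   the energy of h itself. Hence h' = 0, so h = h(0) = 0, and m gamma = rho q is a C2 solution. *)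
theory Submission
  imports Defs
begin

text \<open>Criticality inside the symmetric class only speaks about symmetric variations, so the
  equation cannot be tested against arbitrary ones. Neither a projection of general variations nor a
  principle of symmetric criticality enters: a single admissible direction, the discrepancy between
  the curve and its expected value, already decides the matter. Regularity comes at the same time,
  since an H1 curve gets identified with one that is C2 by construction.

  The price is that the antiderivative has to lie exactly in the symmetry class. Its two constants
  of integration are used up by closing the curve after one period and by oddness; the remaining
  half-period symmetry must then hold by itself.

  The second obstacle is the low regularity. A weak derivative is known on one period only, up to a
  null set, and enters the kinetic energy through an arbitrary choice. Hence the uniqueness result,
  the explicit wrap-around for time-shifted bodies, and an integration by parts proved through
  Fubini instead of a pointwise product rule.\<close>

section \<open>Weak derivatives\<close>

text \<open>The Borel sets over which \<open>f\<close> integrates to zero form a Dynkin system (the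
  total integral gives complements), and the half-lines are an intersection-stable generator.
  Uniqueness of densities then turns vanishing integrals into a null function.\<close>

lemma AE_zero_if_initial_integrals_zero:
  fixes f :: "real \<Rightarrow> 'a::euclidean_space"
  assumes f: "integrable lborel f"
    and total: "(LBINT x. f x) = 0"
    and initial: "\<And>a. (LBINT x:{..a}. f x) = 0"
  shows "AE x in lborel. f x = 0"
proof -
  have meas: "\<And>A. A \<in> sets borel \<Longrightarrow> set_integrable lborel A f"
    unfolding set_integrable_def using f by (intro integrable_mult_indicator) auto
  have zero: "(LBINT x:A. f x) = 0" if "A \<in> sets borel" for A
  proof -
    have sets: "sets borel = sigma_sets UNIV (range (\<lambda>a::real. {..a}))"
      by (simp add: borel_eq_atMost sets_measure_of)
    have "Int_stable (range (\<lambda>a::real. {..a}))"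
      by (auto simp: Int_stable_def)
    moreover have "range (\<lambda>a::real. {..a}) \<subseteq> Pow UNIV" by auto
    moreover have "A \<in> sigma_sets UNIV (range (\<lambda>a::real. {..a}))"
      using that unfolding sets .
    ultimately show ?thesis
    proof (induction rule: sigma_sets_induct_disjoint)
      case (basic A) then show ?case using initial by auto
    next
      case empty then show ?case by (simp add: set_lebesgue_integral_def)
    next
      case (compl A)
      have A: "A \<in> sets borel"
        using compl(1) unfolding sets .
      have "(LBINT x:A \<union> (UNIV - A). f x) = (LBINT x:A. f x) + (LBINT x:UNIV - A. f x)"
        using A by (intro set_integral_Un meas) auto
      then show ?case using compl total by (simp add: set_lebesgue_integral_def)
    next
      case (union A)
      have A: "A i \<in> sets borel" for i
        using union(2) unfolding sets by auto
      have "(LBINT x:(\<Union>i. A i). f x) = (\<Sum>i. (LBINT x:A i. f x))"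
        using A union(1) by (intro lebesgue_integral_countable_add meas) (auto simp: disjoint_family_on_def)
      then show ?case using union by simp
    qed
  qed
  have "AE x in lborel. f x = (\<lambda>_. 0) x"
    by (rule sigma_finite_measure.density_unique_banach[OF lborel.sigma_finite_measure_axioms]) (use f zero in auto)
  then show ?thesis by simp
qed

lemma has_weak_deriv_initial:
  "has_weak_deriv f g \<Longrightarrow> t \<in> {0..2*pi} \<Longrightarrow> f t = f 0 + (LBINT s:{0..t}. g s)"
  and has_weak_deriv_integrable:
  "has_weak_deriv f g \<Longrightarrow> set_integrable lborel {0..2*pi} g"
  and has_weak_deriv_square_integrable:
  "has_weak_deriv f g \<Longrightarrow> set_integrable lborel {0..2*pi} (\<lambda>t. (norm (g t))\<^sup>2)"
  unfolding has_weak_deriv_def by blast+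

text \<open>The initial integrals of a weak derivative are determined by the function, so the
  difference of two weak derivatives, cut off to the period, integrates to zero over every
  half-line. This makes the choice in \<open>weak_deriv\<close> harmless for the kinetic
  energy.\<close>

lemma has_weak_deriv_unique:
  assumes "has_weak_deriv f g" "has_weak_deriv f h"
  shows "AE t\<in>{0..2*pi} in lborel. g t = h t"
proof -
  let ?k = "\<lambda>t. indicator {0..2*pi} t *\<^sub>R (g t - h t)"
  note ints = assms[THEN has_weak_deriv_integrable]
  have init: "(LBINT s:{0..t}. g s - h s) = 0" if "t \<in> {0..2*pi}" for t
  proof -
    have "set_integrable lborel {0..t} g" "set_integrable lborel {0..t} h"
      using that ints by (auto intro: set_integrable_subset)
    then show ?thesis
      using has_weak_deriv_initial[OF assms(1) that] has_weak_deriv_initial[OF assms(2) that]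
      by (simp add: set_integral_diff)
  qed
  have total: "(LBINT x. ?k x) = 0"
    using init[of "2*pi"] by (simp add: set_lebesgue_integral_def)
  have "AE x in lborel. ?k x = 0"
  proof (rule AE_zero_if_initial_integrals_zero)
    show "integrable lborel ?k"
      using set_integral_diff(1)[OF ints] by (simp add: set_integrable_def)
    fix a :: real
    have eq: "(LBINT x:{..a}. ?k x) = (LBINT x:{..a} \<inter> {0..2*pi}. g x - h x)"
      unfolding set_lebesgue_integral_def
      by (intro Bochner_Integration.integral_cong) (auto simp: indicator_def)
    consider "a < 0" | "a \<in> {0..2*pi}" | "a > 2*pi" by fastforce
    then show "(LBINT x:{..a}. ?k x) = 0"
    proof cases
      case 1
      then have "{..a} \<inter> {0..2*pi} = {}" by auto
      then show ?thesis unfolding eq by (simp add: set_lebesgue_integral_def)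
    next
      case 2
      then have "{..a} \<inter> {0..2*pi} = {0..a}" by auto
      then show ?thesis unfolding eq using init[OF 2] by (simp only:)
    next
      case 3
      then have "{..a} \<inter> {0..2*pi} = {0..2*pi}" by auto
      then show ?thesis unfolding eq using init[of "2*pi"] by (simp only:) simp
    qed
  qed (fact total)
  then show ?thesis by eventually_elim (auto simp: indicator_def split: if_splits)
qed

lemma has_weak_deriv_weak_deriv:
  assumes "f \<in> H1_loops"
  shows "has_weak_deriv f (weak_deriv f)"
proof -
  have "\<exists>g. has_weak_deriv f g" using assms unfolding H1_loops_def by blast
  then show ?thesis unfolding weak_deriv_def by (rule someI_ex)
qed

lemma H1_loopsI:
  "(\<And>t. f (t + 2*pi) = f t) \<Longrightarrow> has_weak_deriv f g \<Longrightarrow> f \<in> H1_loops"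
  unfolding H1_loops_def by blast

lemma H1_loops_periodic: "f \<in> H1_loops \<Longrightarrow> f (t + 2*pi) = f t"
  by (simp add: H1_loops_def)

lemma has_weak_deriv_bounded_linear:
  fixes f g :: "real \<Rightarrow> 'a::euclidean_space" and L :: "'a \<Rightarrow> 'b::euclidean_space"
  assumes "has_weak_deriv f g" and L: "bounded_linear L"
  shows "has_weak_deriv (\<lambda>t. L (f t)) (\<lambda>t. L (g t))"
proof -
  interpret bounded_linear L by fact
  have int: "set_integrable lborel A (\<lambda>t. L (g t))" if "set_integrable lborel A g" for A
    using integrable_bounded_linear[OF L that[unfolded set_integrable_def]]
    by (simp add: set_integrable_def scaleR)
  have eq: "(LBINT s:A. L (g s)) = L (LBINT s:A. g s)" if "set_integrable lborel A g" for A
    using integral_bounded_linear[OF L that[unfolded set_integrable_def]]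
    by (simp add: set_lebesgue_integral_def scaleR)
  obtain B where B: "\<And>z. norm (L z) \<le> norm z * B" using bounded by blast
  have g: "set_integrable lborel {0..2*pi} g" using assms(1) by (rule has_weak_deriv_integrable)
  have "set_integrable lborel {0..2*pi} (\<lambda>t. (norm (L (g t)))\<^sup>2)"
  proof (rule set_integrable_bound)
    show "set_integrable lborel {0..2*pi} (\<lambda>t. B\<^sup>2 * (norm (g t))\<^sup>2)"
      using has_weak_deriv_square_integrable[OF assms(1)] by simp
    have "(norm (L z))\<^sup>2 \<le> B\<^sup>2 * (norm z)\<^sup>2" for z
      using power_mono[OF B[of z], of 2] by (simp add: power_mult_distrib mult.commute)
    then show "AE t in lborel. t \<in> {0..2*pi} \<longrightarrow> norm ((norm (L (g t)))\<^sup>2) \<le> norm (B\<^sup>2 * (norm (g t))\<^sup>2)"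
      by simp
    \<comment> \<open>Integrability on the period gives measurability only after multiplication by
      the indicator, which is therefore moved inside the norm.\<close>
    have "(\<lambda>t. (norm (indicator {0..2*pi} t *\<^sub>R L (g t)))\<^sup>2) \<in> borel_measurable lborel"
      using int[OF g, unfolded set_integrable_def] by measurable
    moreover have "(\<lambda>t. (norm (indicator {0..2*pi} t *\<^sub>R L (g t)))\<^sup>2) = (\<lambda>t. indicator {0..2*pi} t *\<^sub>R (norm (L (g t)))\<^sup>2)"
      by (auto simp: indicator_def)
    ultimately show "set_borel_measurable lborel {0..2*pi} (\<lambda>t. (norm (L (g t)))\<^sup>2)"
      by (simp add: set_borel_measurable_def)
  qed
  moreover have "L (f t) = L (f 0) + (LBINT s:{0..t}. L (g s))" if "t \<in> {0..2*pi}" for t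
  proof -
    have "set_integrable lborel {0..t} g"
      using that g by (auto intro: set_integrable_subset)
    then show ?thesis
      using has_weak_deriv_initial[OF assms(1) that] by (simp add: eq add)
  qed
  ultimately show ?thesis using int[OF g] unfolding has_weak_deriv_def by blast
qed

lemma set_integrable_inner_square:
  fixes g h :: "real \<Rightarrow> 'a::euclidean_space"
  assumes g: "set_integrable lborel A g" "set_integrable lborel A (\<lambda>t. (norm (g t))\<^sup>2)"
    and h: "set_integrable lborel A h" "set_integrable lborel A (\<lambda>t. (norm (h t))\<^sup>2)"
  shows "set_integrable lborel A (\<lambda>t. g t \<bullet> h t)"
proof (rule set_integrable_bound)
  show "set_integrable lborel A (\<lambda>t. (norm (g t))\<^sup>2 + (norm (h t))\<^sup>2)"
    using g h by (intro set_integral_add)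
  have "\<bar>a \<bullet> b\<bar> \<le> (norm a)\<^sup>2 + (norm b)\<^sup>2" for a b :: 'a
  proof -
    have "\<bar>a \<bullet> b\<bar> \<le> norm a * norm b" by (rule Cauchy_Schwarz_ineq2)
    also have "\<dots> \<le> (norm a)\<^sup>2 + (norm b)\<^sup>2"
      using sum_squares_bound[of "norm a" "norm b"] mult_nonneg_nonneg[OF norm_ge_zero[of a] norm_ge_zero[of b]] by linarith
    finally show ?thesis .
  qed
  then show "AE t in lborel. t \<in> A \<longrightarrow> norm (g t \<bullet> h t) \<le> norm ((norm (g t))\<^sup>2 + (norm (h t))\<^sup>2)"
    by simp
  have "(\<lambda>t. (indicator A t *\<^sub>R g t) \<bullet> (indicator A t *\<^sub>R h t)) \<in> borel_measurable lborel"
    using g(1) h(1) unfolding set_integrable_def by measurable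
  moreover have "(\<lambda>t. (indicator A t *\<^sub>R g t) \<bullet> (indicator A t *\<^sub>R h t)) = (\<lambda>t. indicator A t *\<^sub>R (g t \<bullet> h t))"
    by (auto simp: indicator_def)
  ultimately show "set_borel_measurable lborel A (\<lambda>t. g t \<bullet> h t)"
    by (simp add: set_borel_measurable_def)
qed

lemma has_weak_deriv_inner_integrable:
  "has_weak_deriv f g \<Longrightarrow> has_weak_deriv f' g' \<Longrightarrow> set_integrable lborel {0..2*pi} (\<lambda>t. g t \<bullet> g' t)"
  by (intro set_integrable_inner_square has_weak_deriv_integrable has_weak_deriv_square_integrable)

lemma has_weak_deriv_add:
  assumes "has_weak_deriv f g" "has_weak_deriv f' g'"
  shows "has_weak_deriv (\<lambda>t. f t + f' t) (\<lambda>t. g t + g' t)"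
proof -
  note ints = assms[THEN has_weak_deriv_integrable]
  have "set_integrable lborel {0..2*pi} (\<lambda>t. (norm (g t))\<^sup>2 + 2 * (g t \<bullet> g' t) + (norm (g' t))\<^sup>2)"
    using assms[THEN has_weak_deriv_square_integrable] has_weak_deriv_inner_integrable[OF assms]
    by (intro set_integral_add set_integrable_mult_right) auto
  moreover have square: "(norm (a + b))\<^sup>2 = (norm a)\<^sup>2 + 2 * (a \<bullet> b) + (norm b)\<^sup>2" for a b :: 'a
    by (simp add: power2_norm_eq_inner inner_simps inner_commute)
  ultimately have "set_integrable lborel {0..2*pi} (\<lambda>t. (norm (g t + g' t))\<^sup>2)"
    by simp
  moreover have "f t + f' t = f 0 + f' 0 + (LBINT s:{0..t}. g s + g' s)" if "t \<in> {0..2*pi}" for t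
  proof -
    have "set_integrable lborel {0..t} g" "set_integrable lborel {0..t} g'"
      using that ints by (auto intro: set_integrable_subset)
    then show ?thesis
      using assms[THEN has_weak_deriv_initial, OF that] by (simp add: set_integral_add)
  qed
  ultimately show ?thesis
    using set_integral_add(1)[OF ints] unfolding has_weak_deriv_def by blast
qed

lemma has_weak_deriv_of_C1:
  fixes f g :: "real \<Rightarrow> 'a::euclidean_space"
  assumes deriv: "\<And>t. (f has_vector_derivative g t) (at t)" and cont: "continuous_on UNIV g"
  shows "has_weak_deriv f g"
  unfolding has_weak_deriv_def
proof (intro conjI ballI)
  have c: "continuous_on {0..t} g" for t using cont continuous_on_subset by blast
  show "set_integrable lborel {0..2*pi} g"
    unfolding set_integrable_def using c by (intro borel_integrable_compact) auto
  show "set_integrable lborel {0..2*pi} (\<lambda>t. (norm (g t))\<^sup>2)"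
    unfolding set_integrable_def using c
    by (intro borel_integrable_compact) (auto intro!: continuous_intros)
  fix t assume "t \<in> {0..2*pi}"
  then have "(LBINT s. indicator {0..t} s *\<^sub>R g s) = f t - f 0"
    using c by (intro integral_FTC_atLeastAtMost) (auto intro: has_vector_derivative_at_within[OF deriv])
  then show "f t = f 0 + (LBINT s:{0..t}. g s)"
    by (simp add: set_lebesgue_integral_def)
qed

section \<open>Rotated loops and integration by parts\<close>

lemma set_integrable_shift_iff:
  fixes g :: "real \<Rightarrow> 'a::{banach, second_countable_topology}"
  shows "set_integrable lborel {t. t + c \<in> A} (\<lambda>t. g (t + c)) \<longleftrightarrow> set_integrable lborel A g"
  using lborel_integrable_real_affine_iff[of 1 "\<lambda>t. indicator A t *\<^sub>R g t" c]
  by (simp add: set_integrable_def indicator_def add.commute)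

lemma set_integral_shift:
  fixes g :: "real \<Rightarrow> 'a::{banach, second_countable_topology}"
  shows "(LBINT t:{t. t + c \<in> A}. g (t + c)) = (LBINT t:A. g t)"
  using lborel_integral_real_affine[of 1 "\<lambda>t. indicator A t *\<^sub>R g t" c]
  by (simp add: set_lebesgue_integral_def indicator_def add.commute)

text \<open>Half-open intervals cut a period into disjoint pieces, as the wrap-around of a
  translation requires; the closed form differs from them by a single null point.\<close>

lemma has_weak_deriv_integral:
  assumes f: "has_weak_deriv f g" and ab: "0 \<le> a" "a \<le> b" "b \<le> 2*pi"
  shows "(LBINT t:{a<..b}. g t) = f b - f a" and "(LBINT t:{a..b}. g t) = f b - f a"
proof -
  have int: "set_integrable lborel A g" if "A \<subseteq> {0..2*pi}" "A \<in> sets borel" for A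
    using set_integrable_subset[OF has_weak_deriv_integrable[OF f]] that by simp
  have "{0..b} = {0..a} \<union> {a<..b}" using ab by auto
  then have "(LBINT t:{0..b}. g t) = (LBINT t:{0..a}. g t) + (LBINT t:{a<..b}. g t)"
    using ab by (simp only:) (intro set_integral_Un int; auto)
  then show 1: "(LBINT t:{a<..b}. g t) = f b - f a"
    using has_weak_deriv_initial[OF f, of a] has_weak_deriv_initial[OF f, of b] ab
    by (simp add: algebra_simps)
  have "(LBINT t:{a..b}. g t) = (LBINT t:{a<..b}. g t)"
    by (rule set_integral_discrete_difference[of "{a}"]) auto
  with 1 show "(LBINT t:{a..b}. g t) = f b - f a" by simp
qed

text \<open>\<^term>\<open>has_weak_deriv\<close> only sees \<open>[0, 2\<pi>]\<close>, where the weak derivative of a loop need not be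
  periodic, so translating it has to wrap around explicitly.\<close>
definition rotate_loop :: "real \<Rightarrow> (real \<Rightarrow> 'a) \<Rightarrow> real \<Rightarrow> 'a" where
  "rotate_loop c g t = (if t \<le> 2*pi - c then g (t + c) else g (t + c - 2*pi))"

text \<open>Translation by \<open>c\<close> breaks the period at \<open>2*pi - c\<close>: before the
  break \<open>g\<close> is read \<open>c\<close> later, after it \<open>2*pi - c\<close> earlier.
  The break point belongs to the first piece, as in \<open>rotate_loop\<close>, so the second piece
  is half-open.\<close>

lemma set_integrable_rotate_loop_parts:
  fixes g :: "real \<Rightarrow> 'a::euclidean_space"
  assumes g: "set_integrable lborel {0..2*pi} g" and c: "0 \<le> c" "c \<le> 2*pi"
  shows "t \<in> {0..2*pi - c} \<Longrightarrow> set_integrable lborel {0..t} (rotate_loop c g)"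
    and "t \<in> {0..2*pi - c} \<Longrightarrow> (LBINT s:{0..t}. rotate_loop c g s) = (LBINT s:{c..t + c}. g s)"
    and "t \<in> {2*pi - c..2*pi} \<Longrightarrow> set_integrable lborel {2*pi - c<..t} (rotate_loop c g)"
    and "t \<in> {2*pi - c..2*pi} \<Longrightarrow>
      (LBINT s:{2*pi - c<..t}. rotate_loop c g s) = (LBINT s:{0<..t + c - 2*pi}. g s)"
proof -
  have int: "set_integrable lborel A g" if "A \<subseteq> {0..2*pi}" "A \<in> sets borel" for A
    using set_integrable_subset[OF g] that by simp
  { assume t: "t \<in> {0..2*pi - c}"
    have A: "{0..t} = {s. s + c \<in> {c..t + c}}" by auto
    have "set_integrable lborel {0..t} (\<lambda>s. g (s + c))"
      unfolding A set_integrable_shift_iff using t c by (intro int) auto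
    moreover have "set_integrable lborel {0..t} (rotate_loop c g) \<longleftrightarrow> set_integrable lborel {0..t} (\<lambda>s. g (s + c))"
      using t by (intro set_integrable_cong) (auto simp: rotate_loop_def)
    ultimately show "set_integrable lborel {0..t} (rotate_loop c g)" by simp
    have "(LBINT s:{0..t}. rotate_loop c g s) = (LBINT s:{0..t}. g (s + c))"
      using t by (intro set_lebesgue_integral_cong) (auto simp: rotate_loop_def)
    also have "\<dots> = (LBINT s:{c..t + c}. g s)"
      unfolding A by (rule set_integral_shift)
    finally show "(LBINT s:{0..t}. rotate_loop c g s) = (LBINT s:{c..t + c}. g s)" . }
  { assume t: "t \<in> {2*pi - c..2*pi}"
    have A: "{2*pi - c<..t} = {s. s + (c - 2*pi) \<in> {0<..t + c - 2*pi}}" by auto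
    have "set_integrable lborel {2*pi - c<..t} (\<lambda>s. g (s + (c - 2*pi)))"
      unfolding A set_integrable_shift_iff using t c by (intro int) auto
    moreover have "set_integrable lborel {2*pi - c<..t} (rotate_loop c g) \<longleftrightarrow>
        set_integrable lborel {2*pi - c<..t} (\<lambda>s. g (s + (c - 2*pi)))"
      using t by (intro set_integrable_cong) (auto simp: rotate_loop_def algebra_simps)
    ultimately show "set_integrable lborel {2*pi - c<..t} (rotate_loop c g)" by simp
    have "(LBINT s:{2*pi - c<..t}. rotate_loop c g s) = (LBINT s:{2*pi - c<..t}. g (s + (c - 2*pi)))"
      using t by (intro set_lebesgue_integral_cong) (auto simp: rotate_loop_def algebra_simps)
    also have "\<dots> = (LBINT s:{0<..t + c - 2*pi}. g s)"
      unfolding A by (rule set_integral_shift)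
    finally show "(LBINT s:{2*pi - c<..t}. rotate_loop c g s) = (LBINT s:{0<..t + c - 2*pi}. g s)" . }
qed

lemma set_integrable_rotate_loop:
  fixes g :: "real \<Rightarrow> 'a::euclidean_space"
  assumes g: "set_integrable lborel {0..2*pi} g" and c: "0 \<le> c" "c \<le> 2*pi"
  shows "set_integrable lborel {0..2*pi} (rotate_loop c g)"
proof -
  have "set_integrable lborel ({0..2*pi - c} \<union> {2*pi - c<..2*pi}) (rotate_loop c g)"
    using set_integrable_rotate_loop_parts[OF assms] c by (intro set_integrable_Un) auto
  moreover have "{0..2*pi - c} \<union> {2*pi - c<..2*pi} = {0..2*pi}" using c by auto
  ultimately show ?thesis by simp
qed

lemma has_weak_deriv_shift:
  fixes f g :: "real \<Rightarrow> 'a::euclidean_space"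
  assumes periodic: "\<And>t. f (t + 2*pi) = f t" and f: "has_weak_deriv f g"
    and c: "0 \<le> c" "c \<le> 2*pi"
  shows "has_weak_deriv (\<lambda>t. f (t + c)) (rotate_loop c g)"
  unfolding has_weak_deriv_def
proof (intro conjI ballI)
  note g = has_weak_deriv_integrable[OF f]
  show "set_integrable lborel {0..2*pi} (rotate_loop c g)"
    using g c by (rule set_integrable_rotate_loop)
  have "set_integrable lborel {0..2*pi} (rotate_loop c (\<lambda>t. (norm (g t))\<^sup>2))"
    using has_weak_deriv_square_integrable[OF f] c by (rule set_integrable_rotate_loop)
  moreover have "rotate_loop c (\<lambda>t. (norm (g t))\<^sup>2) = (\<lambda>t. (norm (rotate_loop c g t))\<^sup>2)"
    by (auto simp: rotate_loop_def)
  ultimately show "set_integrable lborel {0..2*pi} (\<lambda>t. (norm (rotate_loop c g t))\<^sup>2)" by simp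
  fix t :: real assume t: "t \<in> {0..2*pi}"
  note parts = set_integrable_rotate_loop_parts[OF g c]
  show "f (t + c) = f (0 + c) + (LBINT s:{0..t}. rotate_loop c g s)"
  proof (cases "t \<le> 2*pi - c")
    case True
    then show ?thesis using parts(2)[of t] has_weak_deriv_integral(2)[OF f, of c "t + c"] t c by simp
  next
    case False
    have "{0..t} = {0..2*pi - c} \<union> {2*pi - c<..t}" using t c False by auto
    then have "(LBINT s:{0..t}. rotate_loop c g s)
        = (LBINT s:{0..2*pi - c}. rotate_loop c g s) + (LBINT s:{2*pi - c<..t}. rotate_loop c g s)"
      using t c False by (simp only:) (intro set_integral_Un parts; auto)
    also have "\<dots> = (f (2*pi) - f c) + (f (t + c - 2*pi) - f 0)"
      using parts(2)[of "2*pi - c"] parts(4)[of t] t c False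
        has_weak_deriv_integral(2)[OF f, of c "2*pi"] has_weak_deriv_integral(1)[OF f, of 0 "t + c - 2*pi"]
      by simp
    \<comment> \<open>The increments before and after the wrap-around telescope because
      \<open>f (2*pi) = f 0\<close>.\<close>
    also have "\<dots> = f (t + c) - f c"
      using periodic[of 0] periodic[of "t + c - 2*pi"] by simp
    finally show ?thesis by simp
  qed
qed

section \<open>Closure properties of H1 loops and their continuity\<close>

lemma H1_loops_shift:
  fixes f :: "real \<Rightarrow> 'a::euclidean_space"
  assumes "f \<in> H1_loops" "0 \<le> c" "c \<le> 2*pi"
  shows "(\<lambda>t. f (t + c)) \<in> H1_loops"
proof (rule H1_loopsI)
  show "f (t + 2*pi + c) = f (t + c)" for t
    using H1_loops_periodic[OF assms(1), of "t + c"] by (simp add: algebra_simps)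
  show "has_weak_deriv (\<lambda>t. f (t + c)) (rotate_loop c (weak_deriv f))"
    using assms by (intro has_weak_deriv_shift H1_loops_periodic has_weak_deriv_weak_deriv)
qed

lemma H1_loops_add:
  fixes f g :: "real \<Rightarrow> 'a::euclidean_space"
  assumes "f \<in> H1_loops" "g \<in> H1_loops"
  shows "(\<lambda>t. f t + g t) \<in> H1_loops"
  by (rule H1_loopsI[OF _ has_weak_deriv_add[OF assms[THEN has_weak_deriv_weak_deriv]]])
    (simp add: assms[THEN H1_loops_periodic])

lemma H1_loops_bounded_linear:
  fixes f :: "real \<Rightarrow> 'a::euclidean_space" and L :: "'a \<Rightarrow> 'b::euclidean_space"
  assumes "f \<in> H1_loops" "bounded_linear L"
  shows "(\<lambda>t. L (f t)) \<in> H1_loops"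
  by (rule H1_loopsI[OF _ has_weak_deriv_bounded_linear[OF has_weak_deriv_weak_deriv[OF assms(1)] assms(2)]])
    (simp add: H1_loops_periodic[OF assms(1)])

lemma has_weak_deriv_continuous:
  fixes f g :: "real \<Rightarrow> 'a::euclidean_space"
  assumes f: "has_weak_deriv f g"
  shows "continuous_on {0..2*pi} f"
proof -
  have int: "set_integrable lborel {0..t} g" if "t \<in> {0..2*pi}" for t
    using set_integrable_subset[OF has_weak_deriv_integrable[OF f]] that by simp
  have "continuous_on {0..2*pi} (\<lambda>t. f 0 + integral {0..t} g)"
    using set_borel_integral_eq_integral(1)[OF has_weak_deriv_integrable[OF f]]
    by (intro continuous_intros indefinite_integral_continuous_1)
  moreover have "f 0 + integral {0..t} g = f t" if "t \<in> {0..2*pi}" for t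
    using has_weak_deriv_initial[OF f that] set_borel_integral_eq_integral(2)[OF int[OF that]] by argo
  ultimately show ?thesis by (rule continuous_on_eq)
qed

lemma periodic_add_int:
  fixes f :: "real \<Rightarrow> 'a"
  assumes periodic: "\<And>t. f (t + c) = f t"
  shows "f (t + of_int k * c) = f t"
proof (induction k rule: int_induct[of _ 0])
  case (step1 i)
  then show ?case using periodic[of "t + of_int i * c"] by (simp add: algebra_simps)
next
  case (step2 i)
  then show ?case using periodic[of "t + of_int (i - 1) * c"] by (simp add: algebra_simps)
qed simp

text \<open>Continuity on one closed period is only one-sided at its endpoints. Gluing two periods
  makes the junction an interior point, and every time is a translate of an interior point of
  \<open>{0..2*c}\<close>.\<close>

lemma periodic_continuous:
  fixes f :: "real \<Rightarrow> 'a::real_normed_vector"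
  assumes periodic: "\<And>t. f (t + c) = f t" and c: "c > 0" and cont: "continuous_on {0..c} f"
  shows "continuous_on UNIV f"
proof -
  have "continuous_on {c..2*c} (f \<circ> (\<lambda>t. t - c))"
    by (intro continuous_on_compose continuous_on_subset[OF cont] continuous_intros) auto
  moreover have "f \<circ> (\<lambda>t. t - c) = f"
    using periodic[of "t - c" for t] by auto
  ultimately have "continuous_on ({0..c} \<union> {c..2*c}) f"
    using cont by (intro continuous_on_closed_Un) auto
  moreover have "{0..c} \<union> {c..2*c} = {0..2*c}" using c by auto
  ultimately have "continuous_on {0..2*c} f" by simp
  then have *: "isCont f s" if "0 < s" "s < 2*c" for s
    using that continuous_on_interior[of "{0..2*c}" f s] by (simp add: interior_atLeastAtMost_real)
  have "isCont f t" for t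
  proof -
    \<comment> \<open>Subtracting one places \<open>t - d\<close> in the interval from
      \<open>c\<close> (included) to \<open>2*c\<close> (excluded), strictly inside the glued
      interval.\<close>
    define k where "k = \<lfloor>t / c\<rfloor> - 1"
    define d where "d = of_int k * c"
    have "of_int \<lfloor>t / c\<rfloor> * c \<le> t" "t < (of_int \<lfloor>t / c\<rfloor> + 1) * c"
      using c by (rule floor_divide_lower floor_divide_upper)+
    then have "0 < t - d" "t - d < 2*c"
      using c by (auto simp: d_def k_def algebra_simps)
    then have "isCont f (t - d)" by (rule *)
    then have "isCont (\<lambda>t. f (t - d)) t"
      by (intro isCont_o2[where g = f and f = "\<lambda>t. t - d"]) auto
    moreover have "(\<lambda>t. f (t - d)) = f"
    proof
      show "f (t - d) = f t" for t
        using periodic_add_int[where f = f and k = k and t = "t - d", OF periodic] by (simp add: d_def)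
    qed
    ultimately show ?thesis by simp
  qed
  then show ?thesis by (simp add: continuous_on_eq_continuous_at)
qed

lemma H1_loops_continuous:
  fixes f :: "real \<Rightarrow> 'a::euclidean_space"
  assumes "f \<in> H1_loops"
  shows "continuous_on UNIV f"
  using periodic_continuous[of f "2*pi"] H1_loops_periodic[OF assms]
    has_weak_deriv_continuous[OF has_weak_deriv_weak_deriv[OF assms]] by simp

lemma set_integrable_continuous_Icc:
  fixes f :: "real \<Rightarrow> 'a::euclidean_space"
  assumes "continuous_on {a..b} f"
  shows "set_integrable lborel {a..b} f"
  unfolding set_integrable_def using assms by (intro borel_integrable_compact) auto

text \<open>The function \<open>f\<close> is only an integral of \<open>g\<close>, so no product
  rule holds at every point. Writing \<open>f t - f 0\<close> as an integral of \<open>g\<close> and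
  \<open>p (2*pi) - p s\<close> as an integral of \<open>p'\<close> turns both sides into iterated
  integrals of the same function over a triangle.\<close>

lemma has_weak_deriv_by_parts:
  fixes f g p p' :: "real \<Rightarrow> 'a::euclidean_space"
  assumes f: "has_weak_deriv f g"
    and p: "\<And>t. (p has_vector_derivative p' t) (at t)" and p': "continuous_on UNIV p'"
  shows "(LBINT t:{0..2*pi}. p' t \<bullet> f t) =
    p (2*pi) \<bullet> f (2*pi) - p 0 \<bullet> f 0 - (LBINT t:{0..2*pi}. p t \<bullet> g t)"
proof -
  \<comment> \<open>Both factors are extended by zero, so that they are measurable on the whole line
    and the triangle can be treated inside the full plane.\<close>
  define \<phi> where "\<phi> t = indicator {0..2*pi} t *\<^sub>R p' t" for t :: real
  define k where "k t = indicator {0..2*pi} t *\<^sub>R g t" for t :: real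
  define F where "F t s = indicator {..t} s * (\<phi> t \<bullet> k s)" for t s :: real
  have contp: "continuous_on A p" for A
    using p has_vector_derivative_continuous by (metis continuous_at_imp_continuous_on)
  have contp': "continuous_on A p'" for A using p' continuous_on_subset by blast
  have p'int: "set_integrable lborel {a..b} p'" for a b
    by (intro set_integrable_continuous_Icc contp')
  have FTC: "(LBINT t:{a..b}. p' t) = p b - p a" if "a \<le> b" for a b
    unfolding set_lebesgue_integral_def using that contp'
    by (intro integral_FTC_atLeastAtMost) (auto intro: has_vector_derivative_at_within[OF p])
  have g: "set_integrable lborel {0..2*pi} g" using f by (rule has_weak_deriv_integrable)
  have gt: "set_integrable lborel {0..t} g" if "t \<in> {0..2*pi}" for t
    using set_integrable_subset[OF g] that by simp
  have int\<phi>: "integrable lborel \<phi>" and intk: "integrable lborel k"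
    using p'int g by (simp_all add: \<phi>_def[abs_def] k_def[abs_def] set_integrable_def)
  have meas[measurable]: "\<phi> \<in> borel_measurable borel" "k \<in> borel_measurable borel"
    using int\<phi> intk by auto
  have inner: "set_integrable lborel {0..2*pi} (\<lambda>t. p t \<bullet> g t)"
    using f contp by (intro set_integrable_inner_square set_integrable_continuous_Icc continuous_intros
        has_weak_deriv_integrable has_weak_deriv_square_integrable)
  \<comment> \<open>Fubini on the triangle \<open>s \<le> t\<close>\<close>
  have "integrable (lborel \<Otimes>\<^sub>M lborel) (\<lambda>(t, s). norm (\<phi> t) * norm (k s))"
  proof (rule lborel_pair.Fubini_integrable)
    show "(\<lambda>(t, s). norm (\<phi> t) * norm (k s)) \<in> borel_measurable (lborel \<Otimes>\<^sub>M lborel)" by measurable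
    show "integrable lborel (\<lambda>t. LBINT s. norm (case (t, s) of (t, s) \<Rightarrow> norm (\<phi> t) * norm (k s)))"
      using int\<phi> intk by (simp add: abs_mult)
    show "AE t in lborel. integrable lborel (\<lambda>s. case (t, s) of (t, s) \<Rightarrow> norm (\<phi> t) * norm (k s))"
      using intk by simp
  qed
  then have "integrable (lborel \<Otimes>\<^sub>M lborel) (case_prod F)"
  proof (rule Bochner_Integration.integrable_bound)
    have eq: "F = (\<lambda>t s. if s \<le> t then \<phi> t \<bullet> k s else 0)"
      by (auto simp: F_def fun_eq_iff indicator_def)
    show "case_prod F \<in> borel_measurable (lborel \<Otimes>\<^sub>M lborel)" unfolding eq by measurable
    show "AE z in lborel \<Otimes>\<^sub>M lborel. norm (case_prod F z) \<le> norm (case z of (t, s) \<Rightarrow> norm (\<phi> t) * norm (k s))"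
      by (auto simp: F_def indicator_def abs_mult Cauchy_Schwarz_ineq2)
  qed
  then have "(LBINT s. (LBINT t. F t s)) = (LBINT t. (LBINT s. F t s))"
    by (rule lborel_pair.Fubini_integral)
  moreover have "(LBINT s. F t s) = indicator {0..2*pi} t *\<^sub>R (p' t \<bullet> (f t - f 0))" for t
  proof (cases "t \<in> {0..2*pi}")
    case True
    have "(LBINT s. F t s) = (LBINT s. p' t \<bullet> (indicator {0..t} s *\<^sub>R g s))"
      using True by (intro Bochner_Integration.integral_cong) (auto simp: F_def \<phi>_def k_def indicator_def)
    also have "\<dots> = p' t \<bullet> (LBINT s:{0..t}. g s)"
      using gt[OF True] unfolding set_lebesgue_integral_def set_integrable_def
      by (rule integral_inner_right)
    finally show ?thesis using True has_weak_deriv_initial[OF f True] by simp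
  qed (simp add: F_def \<phi>_def)
  moreover have "(LBINT t. F t s) = indicator {0..2*pi} s *\<^sub>R ((p (2*pi) - p s) \<bullet> g s)" for s
  proof (cases "s \<in> {0..2*pi}")
    case True
    have "(LBINT t. F t s) = (LBINT t. (indicator {s..2*pi} t *\<^sub>R p' t) \<bullet> g s)"
      using True by (intro Bochner_Integration.integral_cong) (auto simp: F_def \<phi>_def k_def indicator_def)
    also have "\<dots> = (LBINT t:{s..2*pi}. p' t) \<bullet> g s"
      using p'int[of s "2*pi"] unfolding set_lebesgue_integral_def set_integrable_def
      by (rule integral_inner_left)
    finally show ?thesis using True FTC by simp
  qed (simp add: F_def k_def)
  ultimately have "(LBINT s:{0..2*pi}. (p (2*pi) - p s) \<bullet> g s) = (LBINT t:{0..2*pi}. p' t \<bullet> (f t - f 0))"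
    by (simp add: set_lebesgue_integral_def)
  moreover have "(LBINT s:{0..2*pi}. (p (2*pi) - p s) \<bullet> g s)
      = p (2*pi) \<bullet> (f (2*pi) - f 0) - (LBINT s:{0..2*pi}. p s \<bullet> g s)"
  proof -
    have "set_integrable lborel {0..2*pi} (\<lambda>s. p (2*pi) \<bullet> g s)"
      and "(LBINT s:{0..2*pi}. p (2*pi) \<bullet> g s) = p (2*pi) \<bullet> (LBINT s:{0..2*pi}. g s)"
      using integrable_inner_right[of "p (2*pi)", OF g[unfolded set_integrable_def]]
        integral_inner_right[of "p (2*pi)", OF g[unfolded set_integrable_def]]
      by (simp_all add: set_integrable_def set_lebesgue_integral_def)
    then show ?thesis
      using inner has_weak_deriv_initial[OF f, of "2*pi"] by (simp add: inner_diff_left set_integral_diff)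
  qed
  moreover have "(LBINT t:{0..2*pi}. p' t \<bullet> (f t - f 0))
      = (LBINT t:{0..2*pi}. p' t \<bullet> f t) - (p (2*pi) - p 0) \<bullet> f 0"
  proof -
    have "set_integrable lborel {0..2*pi} (\<lambda>t. p' t \<bullet> f t)"
      by (intro set_integrable_continuous_Icc continuous_intros contp' has_weak_deriv_continuous[OF f])
    moreover have "set_integrable lborel {0..2*pi} (\<lambda>t. p' t \<bullet> f 0)"
      by (intro set_integrable_continuous_Icc continuous_intros contp')
    moreover have "(LBINT t:{0..2*pi}. p' t \<bullet> f 0) = (LBINT t:{0..2*pi}. p' t) \<bullet> f 0"
      using integral_inner_left[of "f 0", OF p'int[of 0 "2*pi", unfolded set_integrable_def]]
      by (simp add: set_lebesgue_integral_def)
    ultimately show ?thesis by (simp add: inner_diff_right set_integral_diff FTC)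
  qed
  ultimately show ?thesis by (simp add: inner_simps)
qed

section \<open>First variation of the energies\<close>

lemma UNIV_3_eq: "(UNIV :: 3 set) = {0, 1, 2}"
  using UNIV_3 by auto

lemma forall_UNIV_3: "(\<forall>i. P i) \<longleftrightarrow> P 0 \<and> P 1 \<and> P (2 :: 3)"
  using UNIV_3_eq by (metis UNIV_I empty_iff insert_iff)

lemma less_3: "(0::3) < 1" "(0::3) < 2" "(1::3) < 2"
  by (simp_all add: less_bit1_def bit1.Rep_0 bit1.Rep_1 bit1.Rep_numeral)

lemma sum_UNIV_3: "(\<Sum>i\<in>(UNIV :: 3 set). f i) = f 0 + f 1 + (f 2 :: 'a::ab_group_add)"
  unfolding UNIV_3_eq by simp

lemma potential_expand:
  "potential \<alpha> m q = m\<^sup>2 * norm (q $ 0 - q $ 1) powr (-\<alpha>) + m\<^sup>2 * norm (q $ 0 - q $ 2) powr (-\<alpha>)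
    + m\<^sup>2 * norm (q $ 1 - q $ 2) powr (-\<alpha>)"
proof -
  have "(i, j) \<in> {(0, 1), (0, 2), (1, 2)}" if "i < j" for i j :: 3
  proof -
    have "i \<in> {0, 1, 2}" "j \<in> {0, 1, 2}" using UNIV_3_eq by blast+
    then show ?thesis using that less_3 by (auto dest: less_asym)
  qed
  then have "{(i, j). i < j} = {(0, 1), (0, 2), (1, 2 :: 3)}"
    using less_3 by auto
  then show ?thesis by (simp add: potential_def)
qed

section \<open>Collision-free configurations and the gradient of the potential\<close>

definition noncolliding :: "config \<Rightarrow> bool" where
  "noncolliding q \<longleftrightarrow> (\<forall>i j. i \<noteq> j \<longrightarrow> q $ i \<noteq> q $ j)"

lemma collision_free_iff: "collision_free x \<longleftrightarrow> (\<forall>t. noncolliding (x t))"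
  by (auto simp: collision_free_def noncolliding_def)

lemma noncolliding_iff: "noncolliding q \<longleftrightarrow> q $ 0 \<noteq> q $ 1 \<and> q $ 0 \<noteq> q $ 2 \<and> q $ 1 \<noteq> q $ 2"
  using less_3 by (auto simp: noncolliding_def forall_UNIV_3)

lemma open_noncolliding: "open {q. noncolliding q}"
  unfolding noncolliding_iff
  by (intro open_Collect_conj open_Collect_neq continuous_intros)

text \<open>The gradient of the pair interaction \<open>m^2 * norm z powr (-\<alpha>)\<close> away
  from the origin. At the origin the formula gives 0, a default that lets the force on a body be
  summed over all bodies, itself included.\<close>

definition pair_gradient :: "real \<Rightarrow> real \<Rightarrow> plane \<Rightarrow> plane" where
  "pair_gradient \<alpha> m z = (- \<alpha> * m\<^sup>2 * norm z powr (-\<alpha> - 2)) *\<^sub>R z"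

lemma pair_gradient_zero [simp]: "pair_gradient \<alpha> m 0 = 0"
  by (simp add: pair_gradient_def)

lemma pair_gradient_minus: "pair_gradient \<alpha> m (- z) = - pair_gradient \<alpha> m z"
  by (simp add: pair_gradient_def)

lemma has_derivative_pair_potential:
  assumes "z \<noteq> 0"
  shows "((\<lambda>z. m\<^sup>2 * norm z powr (-\<alpha>)) has_derivative (\<lambda>h. pair_gradient \<alpha> m z \<bullet> h)) (at z)"
proof -
  have "((\<lambda>r. m\<^sup>2 * r powr (-\<alpha>)) has_real_derivative m\<^sup>2 * (-\<alpha> * norm z powr (-\<alpha> - 1))) (at (norm z))"
    using assms by (intro DERIV_cmult has_real_derivative_powr) simp
  then have "GDERIV (\<lambda>z. m\<^sup>2 * norm z powr (-\<alpha>)) z :> (m\<^sup>2 * (-\<alpha> * norm z powr (-\<alpha> - 1))) *\<^sub>R sgn z"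
    by (rule GDERIV_DERIV_compose[OF GDERIV_norm[OF assms]])
  moreover have "(m\<^sup>2 * (-\<alpha> * norm z powr (-\<alpha> - 1))) *\<^sub>R sgn z = pair_gradient \<alpha> m z"
  proof -
    have e: "-\<alpha> - 1 = (-\<alpha> - 2) + 1" by simp
    have "norm z powr (-\<alpha> - 1) = norm z powr (-\<alpha> - 2) * norm z"
      unfolding e powr_add using assms by simp
    then show ?thesis using assms by (simp add: pair_gradient_def sgn_div_norm)
  qed
  ultimately have "GDERIV (\<lambda>z. m\<^sup>2 * norm z powr (-\<alpha>)) z :> pair_gradient \<alpha> m z"
    by (simp only:)
  then show ?thesis by (simp add: gderiv_def inner_commute)
qed

definition potential_gradient :: "real \<Rightarrow> real \<Rightarrow> config \<Rightarrow> config" where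
  "potential_gradient \<alpha> m q = (\<chi> i. \<Sum>j\<in>UNIV. pair_gradient \<alpha> m (q $ i - q $ j))"

text \<open>Each pair occurs once in \<open>potential\<close> but is seen from both of its bodies in
  \<open>potential_gradient\<close>; oddness of the pair force reconciles the two.\<close>

lemma has_derivative_potential:
  assumes "noncolliding q"
  shows "(potential \<alpha> m has_derivative (\<lambda>h. potential_gradient \<alpha> m q \<bullet> h)) (at q)"
proof -
  let ?D = "\<lambda>i j h. pair_gradient \<alpha> m (q $ i - q $ j) \<bullet> (h $ i - h $ j)"
  have pair: "((\<lambda>q. m\<^sup>2 * norm (q $ i - q $ j) powr (-\<alpha>)) has_derivative ?D i j) (at q)"
    if "i \<noteq> j" for i j
  proof -
    have "((\<lambda>q. q $ i - q $ j) has_derivative (\<lambda>h. h $ i - h $ j)) (at q)"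
      by (intro derivative_intros bounded_linear_imp_has_derivative bounded_linear_vec_nth)
    moreover have "q $ i - q $ j \<noteq> 0" using assms that by (simp add: noncolliding_def)
    ultimately show ?thesis
      by (rule has_derivative_compose[OF _ has_derivative_pair_potential])
  qed
  have "(potential \<alpha> m has_derivative (\<lambda>h. ?D 0 1 h + ?D 0 2 h + ?D 1 2 h)) (at q)"
    unfolding potential_expand[abs_def] by (intro has_derivative_add pair) auto
  moreover have "p \<bullet> h = p $ 0 \<bullet> h $ 0 + p $ 1 \<bullet> h $ 1 + p $ 2 \<bullet> h $ 2" for p h :: config
    by (simp only: inner_vec_def[of p] sum_UNIV_3)
  then have "?D 0 1 h + ?D 0 2 h + ?D 1 2 h = potential_gradient \<alpha> m q \<bullet> h" for h
    using pair_gradient_minus[of \<alpha> m "q $ 1 - q $ 0"] pair_gradient_minus[of \<alpha> m "q $ 2 - q $ 0"]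
      pair_gradient_minus[of \<alpha> m "q $ 2 - q $ 1"]
    by (simp add: potential_gradient_def sum_UNIV_3 inner_simps)
  ultimately show ?thesis by simp
qed

lemma bounded_linear_axis: "bounded_linear (axis i :: 'a::euclidean_space \<Rightarrow> 'a^'n)"
  unfolding linear_conv_bounded_linear[symmetric]
  by (rule linearI) (auto simp: axis_def vec_eq_iff)

text \<open>Moving body \<open>i\<close> alone is the affine map
  \<open>y |-> q + axis i (y - q $ i)\<close>, so the chain rule picks one component of the full
  gradient.\<close>

lemma body_gradient_eq:
  assumes "noncolliding q"
  shows "body_gradient \<alpha> m i q = potential_gradient \<alpha> m q $ i"
  unfolding body_gradient_def
proof (rule gradient_eq)
  let ?u = "\<lambda>y. \<chi> k. if k = i then y else q $ k"
  have u: "?u = (\<lambda>y. q + axis i (y - q $ i))"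
    by (auto simp: fun_eq_iff vec_eq_iff axis_def)
  have "(?u has_derivative (\<lambda>h. axis i h)) (at (q $ i))"
    unfolding u by (rule derivative_eq_intros bounded_linear.has_derivative[OF bounded_linear_axis] refl | simp)+
  moreover have "?u (q $ i) = q" by (simp add: vec_eq_iff)
  then have "(potential \<alpha> m has_derivative (\<lambda>h. potential_gradient \<alpha> m q \<bullet> h)) (at (?u (q $ i)))"
    using has_derivative_potential[OF assms] by simp
  ultimately have "((\<lambda>y. potential \<alpha> m (?u y)) has_derivative (\<lambda>h. potential_gradient \<alpha> m q \<bullet> axis i h)) (at (q $ i))"
    by (rule has_derivative_compose)
  then show "GDERIV (\<lambda>y. potential \<alpha> m (?u y)) (q $ i) :> potential_gradient \<alpha> m q $ i"
    by (simp add: gderiv_def inner_axis inner_axis' inner_commute)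
qed

lemma continuous_on_pair_gradient:
  assumes "continuous_on S f" "\<And>s. s \<in> S \<Longrightarrow> f s \<noteq> 0"
  shows "continuous_on S (\<lambda>s. pair_gradient \<alpha> m (f s))"
  unfolding pair_gradient_def using assms by (intro continuous_intros) auto

lemma continuous_on_potential_gradient:
  assumes f: "continuous_on S f" and nc: "\<And>s. s \<in> S \<Longrightarrow> noncolliding (f s)"
  shows "continuous_on S (\<lambda>s. potential_gradient \<alpha> m (f s))"
  unfolding potential_gradient_def
proof (intro continuous_on_vec_lambda continuous_on_sum)
  fix i j :: 3
  show "continuous_on S (\<lambda>s. pair_gradient \<alpha> m (f s $ i - f s $ j))"
  proof (cases "i = j")
    case False
    with nc have "f s $ i - f s $ j \<noteq> 0" if "s \<in> S" for s
      using that by (simp add: noncolliding_def)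
    then show ?thesis
      by (intro continuous_on_pair_gradient continuous_intros f)
  qed simp
qed

lemma continuous_on_potential:
  assumes "continuous_on S f" "\<And>s. s \<in> S \<Longrightarrow> noncolliding (f s)"
  shows "continuous_on S (\<lambda>s. potential \<alpha> m (f s))"
proof -
  have "continuous_on {q. noncolliding q} (potential \<alpha> m)"
    using has_derivative_continuous[OF has_derivative_potential]
    by (intro continuous_at_imp_continuous_on) simp
  then show ?thesis
    by (rule continuous_on_compose2[OF _ assms(1)]) (use assms(2) in auto)
qed

text \<open>A compact curve keeps a positive distance \<open>d\<close> from the closed set of
  collisions, and the variation is bounded by some \<open>B\<close>. This yields one parameter range
  valid for all times at once, which differentiation under the integral needs; half of
  \<open>d / B\<close> keeps the displacement strictly below \<open>d\<close>.\<close>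

lemma noncolliding_perturbation:
  fixes x \<eta> :: "real \<Rightarrow> config"
  assumes x: "continuous_on {a..b} x" and \<eta>: "continuous_on {a..b} \<eta>"
    and nc: "\<And>t. t \<in> {a..b} \<Longrightarrow> noncolliding (x t)"
  obtains \<epsilon> where "\<epsilon> > 0" "\<And>e t. \<bar>e\<bar> \<le> \<epsilon> \<Longrightarrow> t \<in> {a..b} \<Longrightarrow> noncolliding (x t + e *\<^sub>R \<eta> t)"
proof -
  have "compact (x ` {a..b})" using x by (intro compact_continuous_image) auto
  then obtain d where d: "d > 0" "(\<Union>q\<in>x ` {a..b}. ball q d) \<subseteq> {q. noncolliding q}"
    using compact_subset_open_imp_ball_epsilon_subset[OF _ open_noncolliding] nc by blast
  have "bounded (\<eta> ` {a..b})" using \<eta> by (intro compact_imp_bounded compact_continuous_image) auto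
  then obtain B where B: "B > 0" "\<And>t. t \<in> {a..b} \<Longrightarrow> norm (\<eta> t) \<le> B"
    by (auto simp: bounded_pos)
  show thesis
  proof
    show "d / (2 * B) > 0" using d B by simp
    fix e t assume e: "\<bar>e\<bar> \<le> d / (2 * B)" and t: "t \<in> {a..b}"
    have "norm (e *\<^sub>R \<eta> t) \<le> d / (2 * B) * B"
      using mult_mono[OF e B(2)[OF t]] d B by simp
    also have "\<dots> < d" using d B by simp
    finally have "x t + e *\<^sub>R \<eta> t \<in> ball (x t) d" by (simp add: dist_norm)
    then show "noncolliding (x t + e *\<^sub>R \<eta> t)" using d t by blast
  qed
qed

text \<open>Differentiation under the integral sign on a compact rectangle of parameters and times
  without collisions, where the derivative of the integrand is jointly continuous. The rule concerns
  gauge integrals, hence the conversions to and from Lebesgue integrals.\<close>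

lemma potential_integral_derivative:
  fixes x \<eta> :: "real \<Rightarrow> config"
  assumes x: "continuous_on UNIV x" and \<eta>: "continuous_on UNIV \<eta>"
    and nc: "\<And>t. noncolliding (x t)"
  shows "((\<lambda>e. potential_integral \<alpha> m (\<lambda>t. x t + e *\<^sub>R \<eta> t)) has_real_derivative
    (LBINT t:{0..2*pi}. potential_gradient \<alpha> m (x t) \<bullet> \<eta> t)) (at 0)"
proof -
  note cont = continuous_on_subset[OF x subset_UNIV] continuous_on_subset[OF \<eta> subset_UNIV]
  obtain \<epsilon> where \<epsilon>: "\<epsilon> > 0" "\<And>e t. \<bar>e\<bar> \<le> \<epsilon> \<Longrightarrow> t \<in> {0..2*pi} \<Longrightarrow> noncolliding (x t + e *\<^sub>R \<eta> t)"
    using noncolliding_perturbation[OF cont nc] by metis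
  let ?U = "{-\<epsilon>..\<epsilon>}"
  let ?f = "\<lambda>e t. potential \<alpha> m (x t + e *\<^sub>R \<eta> t)"
  let ?f' = "\<lambda>e t. potential_gradient \<alpha> m (x t + e *\<^sub>R \<eta> t) \<bullet> \<eta> t"
  have contf: "continuous_on {0..2*pi} (?f e)" if "e \<in> ?U" for e
    using \<epsilon>(2) that by (intro continuous_on_potential continuous_intros cont) auto
  have "((\<lambda>e. integral (cbox 0 (2*pi)) (?f e)) has_field_derivative integral (cbox 0 (2*pi)) (?f' 0)) (at 0 within ?U)"
  proof (rule leibniz_rule_field_derivative)
    fix e t assume e: "e \<in> ?U" and t: "t \<in> cbox 0 (2*pi)"
    have "((\<lambda>e. x t + e *\<^sub>R \<eta> t) has_derivative (\<lambda>h. h *\<^sub>R \<eta> t)) (at e)"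
      by (auto intro!: derivative_eq_intros)
    moreover have "(potential \<alpha> m has_derivative (\<lambda>h. potential_gradient \<alpha> m (x t + e *\<^sub>R \<eta> t) \<bullet> h)) (at (x t + e *\<^sub>R \<eta> t))"
      using \<epsilon>(2) e t by (intro has_derivative_potential) auto
    ultimately have "((\<lambda>e. ?f e t) has_derivative (\<lambda>h. potential_gradient \<alpha> m (x t + e *\<^sub>R \<eta> t) \<bullet> (h *\<^sub>R \<eta> t))) (at e)"
      by (rule has_derivative_compose)
    then have "((\<lambda>e. ?f e t) has_real_derivative ?f' e t) (at e)"
      by (simp add: has_field_derivative_def mult_commute_abs)
    then show "((\<lambda>e. ?f e t) has_real_derivative ?f' e t) (at e within ?U)"
      by (rule has_field_derivative_at_within)
  next
    show "?f e integrable_on cbox 0 (2*pi)" if "e \<in> ?U" for e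
      using contf[OF that] by (simp add: integrable_continuous_real)
    have cx: "continuous_on (?U \<times> cbox 0 (2*pi)) (\<lambda>z. x (snd z))"
      and c\<eta>: "continuous_on (?U \<times> cbox 0 (2*pi)) (\<lambda>z. \<eta> (snd z))"
      by (intro continuous_on_compose2[OF x] continuous_on_compose2[OF \<eta>] continuous_intros subset_UNIV)+
    have "continuous_on (?U \<times> cbox 0 (2*pi)) (\<lambda>z. ?f' (fst z) (snd z))"
      using \<epsilon>(2) by (intro continuous_intros continuous_on_potential_gradient cx c\<eta>) auto
    then show "continuous_on (?U \<times> cbox 0 (2*pi)) (\<lambda>(e, t). ?f' e t)"
      by (simp add: case_prod_beta')
  qed (use \<epsilon> in auto)
  moreover have "at 0 within ?U = at 0"
    using \<epsilon>(1) by (intro at_within_interior) (simp add: interior_atLeastAtMost_real)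
  moreover have "integral (cbox 0 (2*pi)) (?f' 0) = (LBINT t:{0..2*pi}. potential_gradient \<alpha> m (x t) \<bullet> \<eta> t)"
    using nc by (subst set_borel_integral_eq_integral(2))
      (auto intro!: set_integrable_continuous_Icc continuous_intros continuous_on_potential_gradient cont)
  ultimately have "((\<lambda>e. integral {0..2*pi} (?f e)) has_real_derivative
      (LBINT t:{0..2*pi}. potential_gradient \<alpha> m (x t) \<bullet> \<eta> t)) (at 0)"
    by simp
  then show ?thesis
  proof (rule DERIV_cong_ev[OF refl _ refl, THEN iffD1, rotated])
    \<comment> \<open>The two integrals are compared only for small \<open>e\<close>, where the
      perturbed curve is known to avoid collisions and the integrand is continuous.\<close>
    have "eventually (\<lambda>e. e \<in> {-\<epsilon><..<\<epsilon>}) (nhds (0::real))"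
      using \<epsilon>(1) by (intro eventually_nhds_in_open) auto
    then show "\<forall>\<^sub>F e in nhds 0. integral {0..2*pi} (?f e) = potential_integral \<alpha> m (\<lambda>t. x t + e *\<^sub>R \<eta> t)"
    proof eventually_elim
      case (elim e)
      then show ?case unfolding potential_integral_def
        by (subst set_borel_integral_eq_integral(2)) (auto intro!: set_integrable_continuous_Icc contf)
    qed
  qed
qed

lemma potential_integral_pos:
  fixes x :: "real \<Rightarrow> config"
  assumes x: "continuous_on UNIV x" and nc: "\<And>t. noncolliding (x t)" and m: "m \<noteq> 0"
  shows "potential_integral \<alpha> m x > 0"
proof -
  have cont: "continuous_on {0..2*pi} (\<lambda>t. potential \<alpha> m (x t))"
    using nc by (intro continuous_on_potential continuous_on_subset[OF x]) auto
  have pos: "potential \<alpha> m (x t) > 0" for t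
    using nc[of t] m by (simp add: potential_expand noncolliding_iff add_pos_pos)
  have eq: "potential_integral \<alpha> m x = integral {0..2*pi} (\<lambda>t. potential \<alpha> m (x t))"
    unfolding potential_integral_def
    by (rule set_borel_integral_eq_integral(2)[OF set_integrable_continuous_Icc[OF cont]])
  then have "potential_integral \<alpha> m x \<ge> 0"
    using pos by (simp add: integral_nonneg integrable_continuous_real[OF cont] less_imp_le)
  moreover have "potential_integral \<alpha> m x \<noteq> 0"
    unfolding eq using integral_eq_0_iff[OF cont] pos pi_gt_zero less_imp_le
    by (metis atLeastAtMost_iff less_eq_real_def less_irrefl mult_pos_pos zero_less_numeral)
  ultimately show ?thesis by simp
qed

text \<open>Any weak derivative may replace the chosen one. The sum over the bodies becomes the
  inner product of configurations, so that the three bodies can be handled as one curve.\<close>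

lemma kinetic_eq:
  assumes "has_weak_deriv x g"
  shows "kinetic m x = m / 2 * (LBINT t:{0..2*pi}. g t \<bullet> g t)"
proof -
  have some: "has_weak_deriv x (weak_deriv x)"
    unfolding weak_deriv_def by (rule someI[of "has_weak_deriv x", OF assms])
  have "(\<Sum>i\<in>UNIV. m * (norm (q $ i))\<^sup>2) = m * (q \<bullet> q)" for q :: config
    by (simp add: inner_vec_def power2_norm_eq_inner sum_distrib_left)
  then have "kinetic m x = m / 2 * (LBINT t:{0..2*pi}. weak_deriv x t \<bullet> weak_deriv x t)"
    by (simp add: kinetic_def)
  moreover have "(LBINT t:{0..2*pi}. weak_deriv x t \<bullet> weak_deriv x t) = (LBINT t:{0..2*pi}. g t \<bullet> g t)"
    unfolding set_lebesgue_integral_def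
  proof (rule Bochner_Integration.integral_cong_AE)
    show "AE t in lborel. indicator {0..2*pi} t *\<^sub>R (weak_deriv x t \<bullet> weak_deriv x t)
        = indicator {0..2*pi} t *\<^sub>R (g t \<bullet> g t)"
      using has_weak_deriv_unique[OF some assms] by eventually_elim (auto simp: indicator_def)
  qed (use has_weak_deriv_inner_integrable[OF some some] has_weak_deriv_inner_integrable[OF assms assms]
      in \<open>auto simp: set_integrable_def simp del: real_scaleR_def\<close>)
  ultimately show ?thesis by simp
qed

text \<open>The kinetic energy is a quadratic form, so the expansion is exact and its middle
  coefficient is the first variation.\<close>

lemma kinetic_perturbation:
  assumes x: "has_weak_deriv x g" and \<eta>: "has_weak_deriv \<eta> h"
  shows "kinetic m (\<lambda>t. x t + e *\<^sub>R \<eta> t) =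
    kinetic m x + e * (m * (LBINT t:{0..2*pi}. g t \<bullet> h t)) + e\<^sup>2 * kinetic m \<eta>"
proof -
  have "has_weak_deriv (\<lambda>t. e *\<^sub>R \<eta> t) (\<lambda>t. e *\<^sub>R h t)"
    by (rule has_weak_deriv_bounded_linear[OF \<eta> bounded_linear_scaleR_right])
  from has_weak_deriv_add[OF x this]
  have "kinetic m (\<lambda>t. x t + e *\<^sub>R \<eta> t) =
      m / 2 * (LBINT t:{0..2*pi}. (g t + e *\<^sub>R h t) \<bullet> (g t + e *\<^sub>R h t))"
    by (rule kinetic_eq)
  also have "(LBINT t:{0..2*pi}. (g t + e *\<^sub>R h t) \<bullet> (g t + e *\<^sub>R h t))
      = (LBINT t:{0..2*pi}. g t \<bullet> g t + 2 * e * (g t \<bullet> h t) + e\<^sup>2 * (h t \<bullet> h t))"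
    by (simp add: inner_simps inner_commute power2_eq_square algebra_simps)
  also have "\<dots> = (LBINT t:{0..2*pi}. g t \<bullet> g t) + 2 * e * (LBINT t:{0..2*pi}. g t \<bullet> h t)
      + e\<^sup>2 * (LBINT t:{0..2*pi}. h t \<bullet> h t)"
    using has_weak_deriv_inner_integrable[OF x x] has_weak_deriv_inner_integrable[OF x \<eta>]
      has_weak_deriv_inner_integrable[OF \<eta> \<eta>]
    by (simp add: set_integral_add)
  finally show ?thesis by (simp add: kinetic_eq[OF x] kinetic_eq[OF \<eta>] algebra_simps)
qed

text \<open>Serves twice: a choreography with zero kinetic energy would be at rest, and the test
  variation turns out to be constant.\<close>

lemma has_weak_deriv_null_energy:
  fixes f g :: "real \<Rightarrow> 'a::euclidean_space"
  assumes f: "has_weak_deriv f g" and zero: "(LBINT t:{0..2*pi}. g t \<bullet> g t) = 0"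
    and t: "t \<in> {0..2*pi}"
  shows "f t = f 0"
proof -
  have "AE s in lborel. indicator {0..2*pi} s *\<^sub>R (g s \<bullet> g s) = 0"
    using integral_nonneg_eq_0_iff_AE[of lborel "\<lambda>s. indicator {0..2*pi} s *\<^sub>R (g s \<bullet> g s)"]
      has_weak_deriv_inner_integrable[OF f f] zero
    by (simp add: set_integrable_def set_lebesgue_integral_def)
  then have "AE s in lborel. indicator {0..t} s *\<^sub>R g s = 0"
    by eventually_elim (use t in \<open>auto simp: indicator_def split: if_splits\<close>)
  then have "(LBINT s:{0..t}. g s) = 0"
    unfolding set_lebesgue_integral_def by (rule integral_eq_zero_AE)
  then show ?thesis using has_weak_deriv_initial[OF f t] by (metis add.right_neutral)
qed

section \<open>Symmetries of the eight\<close>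

definition reflect :: "plane \<Rightarrow> plane" where
  "reflect z = (\<chi> k. if k = 2 then - z $ k else z $ k)"

lemma reflect_nth [simp]: "reflect z $ 1 = z $ 1" "reflect z $ 2 = - z $ 2"
  by (simp_all add: reflect_def)

lemma plane_eq_iff: "z = w \<longleftrightarrow> z $ 1 = w $ 1 \<and> z $ 2 = (w :: plane) $ 2"
  by (auto simp: vec_eq_iff forall_2)

lemma bounded_linear_reflect: "bounded_linear reflect"
  unfolding linear_conv_bounded_linear[symmetric]
  by (rule linearI) (simp_all add: plane_eq_iff)

lemma norm_reflect: "norm (reflect z) = norm z"
  by (simp add: norm_vec_def L2_set_def sum_2)

lemma pair_gradient_reflect: "pair_gradient \<alpha> m (reflect z) = reflect (pair_gradient \<alpha> m z)"
  by (simp add: pair_gradient_def norm_reflect linear_simps[OF bounded_linear_reflect])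

text \<open>Reflection about \<open>pi/2\<close>, taken at \<open>pi/2 - t\<close>, gives
  \<open>\<gamma> (pi - t) = - reflect (\<gamma> t)\<close>, whereas the half-period symmetry gives
  \<open>reflect (\<gamma> (- t))\<close> for the same point; cancelling \<open>reflect\<close>
  leaves oddness. Conversely, oddness at time 0 puts the curve at the origin.\<close>

lemma eight_generators_iff:
  "\<gamma> \<in> eight_generators \<longleftrightarrow>
    \<gamma> \<in> H1_loops \<and> (\<forall>t. \<gamma> (t + pi) = reflect (\<gamma> t)) \<and> (\<forall>t. \<gamma> (- t) = - \<gamma> t)"
proof (intro iffI conjI allI)
  assume \<gamma>: "\<gamma> \<in> eight_generators"
  then show "\<gamma> \<in> H1_loops" by (simp add: eight_generators_def)
  show Ax: "\<gamma> (t + pi) = reflect (\<gamma> t)" for t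
    using \<gamma> by (simp add: eight_generators_def plane_eq_iff)
  have Y: "\<gamma> (pi/2 + s) $ 1 = - \<gamma> (pi/2 - s) $ 1" "\<gamma> (pi/2 + s) $ 2 = \<gamma> (pi/2 - s) $ 2" for s
    using \<gamma> by (simp_all add: eight_generators_def)
  fix t
  have "pi/2 + (pi/2 - t) = - t + pi" by simp
  then show "\<gamma> (- t) = - \<gamma> t"
    using Y[of "pi/2 - t"] Ax[of "- t"] by (simp add: plane_eq_iff)
next
  assume *: "\<gamma> \<in> H1_loops \<and> (\<forall>t. \<gamma> (t + pi) = reflect (\<gamma> t)) \<and> (\<forall>t. \<gamma> (- t) = - \<gamma> t)"
  then have Ax: "\<And>t. \<gamma> (t + pi) = reflect (\<gamma> t)" and odd: "\<And>t. \<gamma> (- t) = - \<gamma> t" by auto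
  have "\<gamma> 0 = 0" using odd[of 0] by (simp add: plane_eq_iff)
  moreover have "\<gamma> (pi/2 + t) = - reflect (\<gamma> (pi/2 - t))" for t
  proof -
    have "pi/2 + t = - (pi/2 - t) + pi" by simp
    then have "\<gamma> (pi/2 + t) = reflect (\<gamma> (- (pi/2 - t)))" using Ax by metis
    also have "\<dots> = - reflect (\<gamma> (pi/2 - t))"
      unfolding odd by (simp add: linear_simps[OF bounded_linear_reflect])
    finally show ?thesis .
  qed
  ultimately show "\<gamma> \<in> eight_generators"
    using * Ax by (simp add: eight_generators_def)
qed

text \<open>Written as a sum of bounded linear images of translates, so that H1 regularity and
  derivatives pass from the generator to the configuration by the general closure rules.\<close>

definition choreography :: "(real \<Rightarrow> plane) \<Rightarrow> real \<Rightarrow> config" where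
  "choreography \<gamma> t = axis 0 (\<gamma> t) + axis 1 (\<gamma> (t + 2*pi/3)) + axis 2 (\<gamma> (t + 4*pi/3))"

lemma choreography_nth [simp]:
  "choreography \<gamma> t $ 0 = \<gamma> t" "choreography \<gamma> t $ 1 = \<gamma> (t + 2*pi/3)"
  "choreography \<gamma> t $ 2 = \<gamma> (t + 4*pi/3)"
  using less_3 by (auto simp: choreography_def axis_def)

lemma config_eq_iff: "p = q \<longleftrightarrow> p $ 0 = q $ 0 \<and> p $ 1 = q $ 1 \<and> p $ 2 = (q :: config) $ 2"
  by (auto simp: vec_eq_iff forall_UNIV_3)

lemma H_eight_iff: "x \<in> H_eight \<longleftrightarrow> (\<exists>\<gamma>\<in>eight_generators. x = choreography \<gamma>)"
  by (simp add: H_eight_def fun_eq_iff config_eq_iff)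

lemma choreography_H1_loops:
  assumes "\<gamma> \<in> H1_loops"
  shows "choreography \<gamma> \<in> H1_loops"
  unfolding choreography_def[abs_def]
  by (intro H1_loops_add H1_loops_bounded_linear[OF _ bounded_linear_axis] H1_loops_shift assms) auto

lemma choreography_combination:
  "choreography (\<lambda>t. a *\<^sub>R \<gamma> t + b *\<^sub>R \<delta> t) t = a *\<^sub>R choreography \<gamma> t + b *\<^sub>R choreography \<delta> t"
  by (simp add: config_eq_iff)

section \<open>Derivatives of choreographies and antiderivatives with symmetry\<close>

lemma has_vector_derivative_affine:
  assumes "(f has_vector_derivative f') (at (c * t + d))"
  shows "((\<lambda>t. f (c * t + d)) has_vector_derivative c *\<^sub>R f') (at t)"
proof -
  have "((\<lambda>t. c * t + d) has_vector_derivative c) (at t)"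
    by (auto intro!: derivative_eq_intros simp: has_real_derivative_iff_has_vector_derivative[symmetric])
  from vector_diff_chain_at[OF this assms] show ?thesis by (simp add: o_def)
qed

lemma has_vector_derivative_choreography:
  assumes "\<And>t. (\<gamma> has_vector_derivative \<gamma>' t) (at t)"
  shows "(choreography \<gamma> has_vector_derivative choreography \<gamma>' t) (at t)"
proof -
  have "((\<lambda>t. \<gamma> (t + d)) has_vector_derivative \<gamma>' (t + d)) (at t)" for d
    using has_vector_derivative_affine[of \<gamma> "\<gamma>' (t + d)" 1 t d] assms by simp
  then show ?thesis
    unfolding choreography_def[abs_def]
    by (intro has_vector_derivative_add bounded_linear.has_vector_derivative[OF bounded_linear_axis] assms)
qed

lemma has_vector_derivative_zero_eq:
  fixes f :: "real \<Rightarrow> 'a::real_normed_vector"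
  assumes "\<And>t. (f has_vector_derivative 0) (at t)"
  shows "f s = f t"
  using has_vector_derivative_zero_constant[of UNIV f] assms by (metis UNIV_I convex_UNIV)

text \<open>An odd function has even, hence here periodic, antiderivatives. Removing the mean of
  such an antiderivative makes the next one periodic, and starting that one at 0 makes it odd. No
  constant is left for the symmetry \<open>S\<close>: the defect \<open>q (t + c) - S (q t)\<close>
  has zero second derivative, and periodicity together with oddness forces it to vanish.\<close>

lemma symmetric_second_antiderivative:
  fixes \<Phi> :: "real \<Rightarrow> 'a::euclidean_space"
  assumes cont: "continuous_on UNIV \<Phi>" and periodic: "\<And>t. \<Phi> (t + 2*c) = \<Phi> t"
    and odd: "\<And>t. \<Phi> (- t) = - \<Phi> t" and shift: "\<And>t. \<Phi> (t + c) = S (\<Phi> t)"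
    and S: "bounded_linear S" and c: "c > 0"
  obtains q p where "\<And>t. (q has_vector_derivative p t) (at t)" "\<And>t. (p has_vector_derivative \<Phi> t) (at t)"
    "\<And>t. q (t + 2*c) = q t" "\<And>t. p (t + 2*c) = p t" "\<And>t. q (- t) = - q t" "\<And>t. q (t + c) = S (q t)"
proof -
  have anti: "\<exists>F. \<forall>t. (F has_vector_derivative f t) (at t)" if "continuous_on UNIV f" for f :: "real \<Rightarrow> 'a"
    using einterval_antiderivative[of "-\<infinity>" "\<infinity>" f] that by (auto simp: continuous_on_eq_continuous_at)
  have derivs: "((\<lambda>t. F (t + d)) has_vector_derivative f (t + d)) (at t)"
    "((\<lambda>t. F (- t)) has_vector_derivative - f (- t)) (at t)"
    if "\<And>t. (F has_vector_derivative f t) (at t)" for F f :: "real \<Rightarrow> 'a" and t d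
    using has_vector_derivative_affine[of F "f (t + d)" 1 t d]
      has_vector_derivative_affine[of F "f (- t)" "-1" t 0] that by simp_all
  obtain P where P: "\<And>t. (P has_vector_derivative \<Phi> t) (at t)"
    using anti[OF cont] by blast
  have "((\<lambda>t. P (- t) - P t) has_vector_derivative - \<Phi> (- t) - \<Phi> t) (at t)" for t
    by (intro has_vector_derivative_diff derivs P)
  then have "P (- t) - P t = P (- 0) - P 0" for t
    using odd by (intro has_vector_derivative_zero_eq[of "\<lambda>t. P (- t) - P t"]) simp
  then have P_even: "P (- t) = P t" for t by simp
  have "((\<lambda>t. P (t + 2*c) - P t) has_vector_derivative \<Phi> (t + 2*c) - \<Phi> t) (at t)" for t
    by (intro has_vector_derivative_diff derivs P)
  \<comment> \<open>Evaluating the constant increment at \<open>- c\<close> compares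
    \<open>P c\<close> with \<open>P (- c)\<close>, which agree by evenness.\<close>
  then have "P (t + 2*c) - P t = P (- c + 2*c) - P (- c)" for t
    using periodic by (intro has_vector_derivative_zero_eq[of "\<lambda>t. P (t + 2*c) - P t"]) simp
  then have P_periodic: "P (t + 2*c) = P t" for t by (simp add: P_even)
  have "continuous_on UNIV P"
    using P by (intro continuous_at_imp_continuous_on) (auto intro: has_vector_derivative_continuous)
  then obtain Q where Q: "\<And>t. (Q has_vector_derivative P t) (at t)"
    using anti by blast
  \<comment> \<open>The mean of \<open>P\<close> over a period; subtracting it makes the second
    antiderivative close up.\<close>
  define b where "b = (1 / (2*c)) *\<^sub>R (Q (2*c) - Q 0)"
  define p where "p t = P t - b" for t
  define q where "q t = Q t - Q 0 - t *\<^sub>R b" for t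
  have q_deriv: "(q has_vector_derivative p t) (at t)" for t
    unfolding q_def[abs_def] p_def using Q by (auto intro!: derivative_eq_intros)
  have p_deriv: "(p has_vector_derivative \<Phi> t) (at t)" for t
    unfolding p_def[abs_def] using P by (auto intro!: derivative_eq_intros)
  have p_periodic: "p (t + 2*c) = p t" for t by (simp add: p_def P_periodic)
  have "((\<lambda>t. q (t + 2*c) - q t) has_vector_derivative p (t + 2*c) - p t) (at t)" for t
    by (intro has_vector_derivative_diff derivs q_deriv)
  then have "q (t + 2*c) - q t = q (0 + 2*c) - q 0" for t
    using p_periodic by (intro has_vector_derivative_zero_eq[of "\<lambda>t. q (t + 2*c) - q t"]) simp
  then have q_periodic: "q (t + 2*c) = q t" for t
    using c by (simp add: q_def b_def)
  have "((\<lambda>t. q (- t) + q t) has_vector_derivative - p (- t) + p t) (at t)" for t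
    by (intro has_vector_derivative_add derivs q_deriv)
  then have "q (- t) + q t = q (- 0) + q 0" for t
    by (intro has_vector_derivative_zero_eq[of "\<lambda>t. q (- t) + q t"]) (simp add: p_def P_even)
  moreover have "q 0 = 0" by (simp add: q_def)
  ultimately have q_odd: "q (- t) = - q t" for t
    by (simp add: eq_neg_iff_add_eq_0)
  interpret S: bounded_linear S by (rule S)
  \<comment> \<open>The derivative of the defect \<open>q (t + c) - S (q t)\<close>; since it is
    constant, the defect is affine with slope \<open>d 0\<close>.\<close>
  define d where "d t = p (t + c) - S (p t)" for t
  have "(d has_vector_derivative \<Phi> (t + c) - S (\<Phi> t)) (at t)" for t
    unfolding d_def[abs_def] by (intro has_vector_derivative_diff derivs S.has_vector_derivative p_deriv)
  then have d: "d t = d 0" for t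
    using shift by (intro has_vector_derivative_zero_eq) simp
  have "((\<lambda>t. q (t + c) - S (q t) - t *\<^sub>R d 0) has_vector_derivative p (t + c) - S (p t) - 1 *\<^sub>R d 0) (at t)" for t
    by (intro has_vector_derivative_diff derivs S.has_vector_derivative q_deriv)
      (auto intro!: derivative_eq_intros)
  then have const: "q (t + c) - S (q t) - t *\<^sub>R d 0 = q (s + c) - S (q s) - s *\<^sub>R d 0" for s t
    using d by (intro has_vector_derivative_zero_eq[of "\<lambda>t. q (t + c) - S (q t) - t *\<^sub>R d 0"])
      (simp add: d_def)
  \<comment> \<open>The defect is also periodic, so its values at 0 and at \<open>2*c\<close> agree
    and the slope is 0.\<close>
  have "d 0 = 0"
    using const[of "2*c" 0] q_periodic[of 0] q_periodic[of c] c by (simp add: add.commute)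
  \<comment> \<open>Modulo the period, \<open>c\<close> and \<open>- c\<close> are the same time, so
    the odd function \<open>q\<close> vanishes there. The defect is therefore 0 at time 0, and its
    constant value is 0.\<close>
  have "q c = - q c" using q_odd[of c] q_periodic[of "- c"] by simp
  then have "2 *\<^sub>R q c = 0" by (metis add.right_inverse scaleR_2)
  then have "q c = 0" by simp
  with const[of _ 0] \<open>d 0 = 0\<close> \<open>q 0 = 0\<close> have "q (t + c) = S (q t)" for t
    by (simp add: S.zero)
  with that q_deriv p_deriv q_periodic p_periodic q_odd show thesis by blast
qed

section \<open>The force along a choreography and its symmetries\<close>

lemma eight_generators_periodic: "\<gamma> \<in> eight_generators \<Longrightarrow> \<gamma> (t + 2*pi) = \<gamma> t"
  unfolding eight_generators_iff using H1_loops_periodic by blast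

text \<open>A time shift by \<open>2*pi/3\<close> permutes the bodies cyclically, and for equal
  masses the interaction does not see the labels. Hence the forces on the other two bodies are
  translates of the force on body 0, and the force field is itself a choreography.\<close>

lemma potential_gradient_choreography:
  assumes periodic: "\<And>t. \<gamma> (t + 2*pi) = \<gamma> t"
  shows "potential_gradient \<alpha> m (choreography \<gamma> t)
    = choreography (\<lambda>t. potential_gradient \<alpha> m (choreography \<gamma> t) $ 0) t"
proof -
  have "t + 2*pi/3 + 4*pi/3 = t + 2*pi" "t + 4*pi/3 + 2*pi/3 = t + 2*pi"
    "t + 2*pi/3 + 2*pi/3 = t + 4*pi/3" "t + 4*pi/3 + 4*pi/3 = t + 2*pi/3 + 2*pi" by simp_all
  then show ?thesis
    unfolding config_eq_iff potential_gradient_def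
    by (simp only: choreography_nth vec_lambda_beta sum_UNIV_3 periodic) simp
qed

text \<open>The pair force commutes with \<open>reflect\<close> and with the change of sign. What
  remains is to match the bodies: a shift by \<open>pi\<close> keeps each body in its role, whereas
  time reversal exchanges bodies 1 and 2.\<close>

lemma potential_gradient_eight_symmetries:
  fixes \<alpha> m :: real
  assumes \<gamma>: "\<gamma> \<in> eight_generators"
  defines "\<Phi> \<equiv> \<lambda>t. potential_gradient \<alpha> m (choreography \<gamma> t) $ 0"
  shows "\<Phi> (t + 2*pi) = \<Phi> t" and "\<Phi> (- t) = - \<Phi> t" and "\<Phi> (t + pi) = reflect (\<Phi> t)"
proof -
  have \<Phi>: "\<Phi> t = pair_gradient \<alpha> m (\<gamma> t - \<gamma> (t + 2*pi/3)) + pair_gradient \<alpha> m (\<gamma> t - \<gamma> (t + 4*pi/3))" for t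
    by (simp add: \<Phi>_def potential_gradient_def sum_UNIV_3)
  have Ax: "\<gamma> (t + pi) = reflect (\<gamma> t)" and odd: "\<gamma> (- t) = - \<gamma> t"
    and periodic: "\<gamma> (t + 2*pi) = \<gamma> t" for t
    using \<gamma> eight_generators_periodic[OF \<gamma>] by (auto simp: eight_generators_iff)
  have "t + 2*pi + 2*pi/3 = t + 2*pi/3 + 2*pi" "t + 2*pi + 4*pi/3 = t + 4*pi/3 + 2*pi" by simp_all
  then show "\<Phi> (t + 2*pi) = \<Phi> t" unfolding \<Phi> by (simp only: periodic)
  have "t + pi + 2*pi/3 = t + 2*pi/3 + pi" "t + pi + 4*pi/3 = t + 4*pi/3 + pi" by simp_all
  then show "\<Phi> (t + pi) = reflect (\<Phi> t)"
    unfolding \<Phi> by (simp only: Ax pair_gradient_reflect linear_simps(1)[OF bounded_linear_reflect]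
      linear_simps(2)[OF bounded_linear_reflect, symmetric])
  \<comment> \<open>The exchange of bodies 1 and 2: the shifts by \<open>- 2*pi/3\<close> and
    \<open>4*pi/3\<close> differ by a full period.\<close>
  have "\<gamma> (- t + 2*pi/3) = - \<gamma> (t + 4*pi/3)" "\<gamma> (- t + 4*pi/3) = - \<gamma> (t + 2*pi/3)"
    using odd[of "t - 2*pi/3"] periodic[of "t - 2*pi/3"] odd[of "t - 4*pi/3"] periodic[of "t - 4*pi/3"]
    by (simp_all add: add.commute)
  then have "\<Phi> (- t) = pair_gradient \<alpha> m (- (\<gamma> t - \<gamma> (t + 4*pi/3))) + pair_gradient \<alpha> m (- (\<gamma> t - \<gamma> (t + 2*pi/3)))"
    unfolding \<Phi> by (simp add: odd)
  then show "\<Phi> (- t) = - \<Phi> t" unfolding pair_gradient_minus by (simp add: \<Phi>)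
qed

text \<open>Origin of the constant: with exponents \<open>a\<close> and \<open>b\<close>, the
  logarithmic derivative \<open>a * k' / k + b * v' / v\<close> vanishes. Multiplying by
  \<open>k / a\<close> gives \<open>k' + (b / a) * (k / v) * v' = 0\<close>, and
  \<open>b / a = 2 / \<alpha>\<close>. Positivity of both energies is what makes the powers
  differentiable.\<close>

lemma critical_first_variation:
  assumes \<alpha>: "0 < \<alpha>" and x: "has_weak_deriv x g" and \<eta>: "has_weak_deriv \<eta> h"
    and contx: "continuous_on UNIV x" and cont\<eta>: "continuous_on UNIV \<eta>"
    and nc: "\<And>t. noncolliding (x t)"
    and K: "kinetic m x > 0" and V: "potential_integral \<alpha> m x > 0"
    and crit: "((\<lambda>e. functional_F \<alpha> m (\<lambda>t. x t + e *\<^sub>R \<eta> t)) has_real_derivative 0) (at 0)"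
  shows "m * (LBINT t:{0..2*pi}. g t \<bullet> h t)
    + 2 * kinetic m x / (\<alpha> * potential_integral \<alpha> m x)
      * (LBINT t:{0..2*pi}. potential_gradient \<alpha> m (x t) \<bullet> \<eta> t) = 0"
proof -
  define k v a b where "k = kinetic m x" and "v = potential_integral \<alpha> m x"
    and "a = \<alpha> / (\<alpha> + 2)" and "b = 2 / (\<alpha> + 2)"
  define k' v' where "k' = m * (LBINT t:{0..2*pi}. g t \<bullet> h t)"
    and "v' = (LBINT t:{0..2*pi}. potential_gradient \<alpha> m (x t) \<bullet> \<eta> t)"
  let ?K = "\<lambda>e. kinetic m (\<lambda>t. x t + e *\<^sub>R \<eta> t)" and ?V = "\<lambda>e. potential_integral \<alpha> m (\<lambda>t. x t + e *\<^sub>R \<eta> t)"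
  have K': "(?K has_real_derivative k') (at 0)"
    unfolding kinetic_perturbation[OF x \<eta>] k'_def by (auto intro!: derivative_eq_intros)
  have V': "(?V has_real_derivative v') (at 0)"
    unfolding v'_def by (rule potential_integral_derivative[OF contx cont\<eta> nc])
  have K0: "?K 0 = k" and V0: "?V 0 = v" and kv: "k > 0" "v > 0"
    using K V by (simp_all add: k_def v_def)
  have "((\<lambda>e. ?K e powr a) has_real_derivative (a * k powr (a - 1)) * k') (at 0)"
    by (rule DERIV_chain2[OF _ K']) (use has_real_derivative_powr[OF kv(1)] K0 in simp)
  moreover have "((\<lambda>e. ?V e powr b) has_real_derivative (b * v powr (b - 1)) * v') (at 0)"
    by (rule DERIV_chain2[OF _ V']) (use has_real_derivative_powr[OF kv(2)] V0 in simp)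
  ultimately have "((\<lambda>e. ?K e powr a * ?V e powr b) has_real_derivative
      (a * k powr (a - 1)) * k' * ?V 0 powr b + (b * v powr (b - 1)) * v' * ?K 0 powr a) (at 0)"
    by (rule DERIV_mult)
  from DERIV_unique[OF this crit[unfolded functional_F_def, folded a_def b_def]]
  have "a * k powr (a - 1) * k' * v powr b + b * v powr (b - 1) * v' * k powr a = 0"
    using K0 V0 by simp
  \<comment> \<open>Splitting off one power of \<open>k\<close> and of \<open>v\<close> exposes a
    common positive factor that can be cancelled.\<close>
  moreover have "k powr a = k powr (a - 1) * k" "v powr b = v powr (b - 1) * v"
    using kv powr_add[of k "a - 1" 1] powr_add[of v "b - 1" 1] by simp_all
  ultimately have "(k powr (a - 1) * v powr (b - 1)) * (a * k' * v + b * v' * k) = 0"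
    by (simp add: algebra_simps)
  then have "a * k' * v + b * v' * k = 0" using kv by simp
  moreover have "a * k' * v + b * v' * k = (\<alpha> * k' * v + 2 * v' * k) / (\<alpha> + 2)"
    by (simp add: a_def b_def add_divide_distrib)
  ultimately have "\<alpha> * k' * v + 2 * v' * k = 0"
    using \<alpha> by simp
  then have "k' + 2 * k / (\<alpha> * v) * v' = 0"
    using \<alpha> kv by (simp add: field_simps)
  then show ?thesis by (simp add: k_def v_def k'_def v'_def)
qed

text \<open>With zero energy the configuration at time \<open>2*pi/3\<close> would equal the one at
  time 0. Reading off body 0, whose position at \<open>2*pi/3\<close> is that of body 1 at time 0,
  this is a collision.\<close>

lemma kinetic_pos:
  assumes "\<gamma> \<in> H1_loops" and nc: "noncolliding (choreography \<gamma> 0)" and m: "m > 0"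
  shows "kinetic m (choreography \<gamma>) > 0"
proof -
  let ?x = "choreography \<gamma>"
  obtain g where g: "has_weak_deriv ?x g"
    using has_weak_deriv_weak_deriv[OF choreography_H1_loops[OF assms(1)]] by blast
  have "(LBINT t:{0..2*pi}. g t \<bullet> g t) \<noteq> 0"
  proof
    assume "(LBINT t:{0..2*pi}. g t \<bullet> g t) = 0"
    then have "?x (2*pi/3) = ?x 0" by (rule has_weak_deriv_null_energy[OF g]) simp
    then have "?x 0 $ 1 = ?x 0 $ 0" by (simp add: config_eq_iff)
    with nc show False by (simp add: noncolliding_iff)
  qed
  moreover have "(LBINT t:{0..2*pi}. g t \<bullet> g t) \<ge> 0"
    unfolding set_lebesgue_integral_def by (intro Bochner_Integration.integral_nonneg) simp
  ultimately show ?thesis using m by (simp add: kinetic_eq[OF g])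
qed

lemma has_second_deriv_rescale:
  assumes "has_second_deriv f a"
  shows "has_second_deriv (\<lambda>s. f (c * s)) (\<lambda>s. c\<^sup>2 *\<^sub>R a (c * s))"
proof -
  obtain v where v: "\<And>t. (f has_vector_derivative v t) (at t)" "\<And>t. (v has_vector_derivative a t) (at t)"
    using assms by (auto simp: has_second_deriv_def)
  have "((\<lambda>s. f (c * s)) has_vector_derivative c *\<^sub>R v (c * s)) (at s)" for s
    using has_vector_derivative_affine[of f "v (c * s)" c s 0] v by simp
  moreover have "((\<lambda>s. c *\<^sub>R v (c * s)) has_vector_derivative c *\<^sub>R (c *\<^sub>R a (c * s))) (at s)" for s
    using has_vector_derivative_affine[of v "a (c * s)" c s 0] v
    by (intro bounded_linear.has_vector_derivative[OF bounded_linear_scaleR_right]) simp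
  ultimately show ?thesis
    unfolding has_second_deriv_def by (intro exI[of _ "\<lambda>s. c *\<^sub>R v (c * s)"]) (simp add: power2_eq_square)
qed

section \<open>The critical equation\<close>

lemma periodic_zero_if_zero_on_period:
  fixes f :: "real \<Rightarrow> 'a::zero"
  assumes periodic: "\<And>t. f (t + c) = f t" and c: "c > 0"
    and zero: "\<And>t. t \<in> {0..c} \<Longrightarrow> f t = 0"
  shows "f t = 0"
proof -
  define s where "s = t - of_int \<lfloor>t / c\<rfloor> * c"
  have "of_int \<lfloor>t / c\<rfloor> * c \<le> t" "t < (of_int \<lfloor>t / c\<rfloor> + 1) * c"
    using c by (rule floor_divide_lower floor_divide_upper)+
  then have "s \<in> {0..c}" by (simp add: s_def algebra_simps)
  moreover have "f t = f s"
    using periodic_add_int[where f = f and k = "\<lfloor>t / c\<rfloor>" and t = s, OF periodic] by (simp add: s_def)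
  ultimately show ?thesis using zero by simp
qed

text \<open>The conclusion names antiderivatives instead of a second derivative of the curve because
  the generator is a priori only H1: it acquires C2 regularity by being a multiple of
  \<open>Q\<close>.\<close>

lemma critical_generator_solves:
  assumes \<alpha>: "0 < \<alpha>" and m: "0 < m" and \<gamma>: "\<gamma> \<in> eight_generators"
    and nc: "\<And>t. noncolliding (choreography \<gamma> t)"
    and crit: "critical_in_H_eight \<alpha> m (choreography \<gamma>)"
    and \<rho>: "\<rho> = 2 * kinetic m (choreography \<gamma>) / (\<alpha> * potential_integral \<alpha> m (choreography \<gamma>))"
  obtains Q P where
    "\<And>t. (Q has_vector_derivative P t) (at t)"
    "\<And>t. (P has_vector_derivative potential_gradient \<alpha> m (choreography \<gamma> t)) (at t)"
    "\<And>t. m *\<^sub>R choreography \<gamma> t = \<rho> *\<^sub>R Q t"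
proof -
  define x where "x = choreography \<gamma>"
  define \<Phi> where "\<Phi> t = potential_gradient \<alpha> m (choreography \<gamma> t) $ 0" for t
  have \<gamma>H1: "\<gamma> \<in> H1_loops" and \<gamma>_periodic: "\<And>t. \<gamma> (t + 2*pi) = \<gamma> t"
    using \<gamma> eight_generators_periodic by (auto simp: eight_generators_iff)
  have xH1: "x \<in> H1_loops" unfolding x_def by (rule choreography_H1_loops[OF \<gamma>H1])
  have contx: "continuous_on UNIV x" by (rule H1_loops_continuous[OF xH1])
  have grad: "potential_gradient \<alpha> m (x t) = choreography \<Phi> t" for t
    unfolding x_def \<Phi>_def[abs_def] by (rule potential_gradient_choreography[where \<gamma> = \<gamma>, OF \<gamma>_periodic])
  have cont_grad: "continuous_on UNIV (\<lambda>t. potential_gradient \<alpha> m (x t))"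
    using nc by (intro continuous_on_potential_gradient contx) (simp add: x_def)
  then have cont\<Phi>: "continuous_on UNIV \<Phi>"
    unfolding \<Phi>_def[abs_def] x_def by (intro continuous_intros)
  note sym = potential_gradient_eight_symmetries[OF \<gamma>, of \<alpha> m, folded \<Phi>_def]
  obtain q p where q: "\<And>t. (q has_vector_derivative p t) (at t)" "\<And>t. (p has_vector_derivative \<Phi> t) (at t)"
    "\<And>t. q (t + 2*pi) = q t" "\<And>t. p (t + 2*pi) = p t" "\<And>t. q (- t) = - q t" "\<And>t. q (t + pi) = reflect (q t)"
    using symmetric_second_antiderivative[OF cont\<Phi> sym(1,2,3) bounded_linear_reflect pi_gt_zero] by blast
  define Q P where "Q = choreography q" and "P = choreography p"
  have Q: "(Q has_vector_derivative P t) (at t)" for t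
    unfolding Q_def P_def by (intro has_vector_derivative_choreography q)
  have P: "(P has_vector_derivative potential_gradient \<alpha> m (x t)) (at t)" for t
    unfolding P_def grad by (intro has_vector_derivative_choreography q)
  have contp: "continuous_on UNIV p" and contP: "continuous_on UNIV P"
    using q(2) P by (auto intro!: continuous_at_imp_continuous_on intro: has_vector_derivative_continuous)
  have qH1: "q \<in> H1_loops"
    using q(3) has_weak_deriv_of_C1[OF q(1) contp] by (rule H1_loopsI)
  \<comment> \<open>Here \<open>\<delta>\<close> is the generator of the test variation and
    \<open>\<eta>\<close> the variation itself; the letter \<open>h\<close> below stands for the
    weak derivative of \<open>\<eta>\<close>.\<close>
  define \<delta> where "\<delta> t = m *\<^sub>R \<gamma> t + (- \<rho>) *\<^sub>R q t" for t
  define \<eta> where "\<eta> t = m *\<^sub>R x t + (- \<rho>) *\<^sub>R Q t" for t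
  have \<eta>_eq: "\<eta> = choreography \<delta>"
    unfolding \<eta>_def[abs_def] \<delta>_def[abs_def] x_def Q_def choreography_combination[symmetric] ..
  have \<delta>: "\<delta> \<in> eight_generators"
    unfolding eight_generators_iff
  proof (intro conjI allI)
    show "\<delta> \<in> H1_loops"
      unfolding \<delta>_def[abs_def]
      by (intro H1_loops_add H1_loops_bounded_linear[OF _ bounded_linear_scaleR_right] \<gamma>H1 qH1)
    show "\<delta> (t + pi) = reflect (\<delta> t)" for t
      using \<gamma> q(6)[of t] by (simp add: \<delta>_def eight_generators_iff linear_simps[OF bounded_linear_reflect])
    show "\<delta> (- t) = - \<delta> t" for t
      using \<gamma> q(5)[of t] by (simp add: \<delta>_def eight_generators_iff)
  qed
  have \<eta>H: "\<eta> \<in> H_eight" using \<delta> \<eta>_eq by (auto simp: H_eight_iff)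
  define g where "g = weak_deriv x"
  define h where "h t = m *\<^sub>R g t + (- \<rho>) *\<^sub>R P t" for t
  have g: "has_weak_deriv x g" unfolding g_def by (rule has_weak_deriv_weak_deriv[OF xH1])
  have QP: "has_weak_deriv Q P" by (rule has_weak_deriv_of_C1[OF Q contP])
  have h: "has_weak_deriv \<eta> h"
    unfolding \<eta>_def[abs_def] h_def[abs_def]
    by (rule has_weak_deriv_add[OF has_weak_deriv_bounded_linear[OF g bounded_linear_scaleR_right]
        has_weak_deriv_bounded_linear[OF QP bounded_linear_scaleR_right]])
  have \<eta>H1: "\<eta> \<in> H1_loops"
    using \<delta> unfolding \<eta>_eq eight_generators_iff by (blast intro: choreography_H1_loops)
  have Kpos: "kinetic m x > 0" unfolding x_def by (rule kinetic_pos[OF \<gamma>H1 nc m])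
  have ncx: "noncolliding (x t)" for t using nc by (simp add: x_def)
  have Vpos: "potential_integral \<alpha> m x > 0"
    using m by (intro potential_integral_pos contx ncx) simp
  have "m * (LBINT t:{0..2*pi}. g t \<bullet> h t)
      + \<rho> * (LBINT t:{0..2*pi}. potential_gradient \<alpha> m (x t) \<bullet> \<eta> t) = 0"
    unfolding \<rho> x_def[symmetric] using crit \<eta>H
    by (intro critical_first_variation \<alpha> g h contx H1_loops_continuous[OF \<eta>H1] ncx Kpos Vpos)
      (simp add: critical_in_H_eight_def x_def)
  \<comment> \<open>Integration by parts against \<open>P\<close>, whose derivative is the gradient;
    the boundary terms cancel because \<open>P\<close> and \<open>\<eta>\<close> both return to
    their initial values.\<close>
  moreover have "(LBINT t:{0..2*pi}. potential_gradient \<alpha> m (x t) \<bullet> \<eta> t) = - (LBINT t:{0..2*pi}. P t \<bullet> h t)"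
  proof -
    have "P (2*pi) = P 0"
      using q(4)[of 0] q(4)[of "2*pi/3"] q(4)[of "4*pi/3"] by (simp add: P_def config_eq_iff add.commute)
    moreover have "\<eta> (2*pi) = \<eta> 0" using H1_loops_periodic[OF \<eta>H1, of 0] by simp
    ultimately show ?thesis
      using has_weak_deriv_by_parts[OF h P cont_grad] by simp
  qed
  ultimately have zero: "m * (LBINT t:{0..2*pi}. g t \<bullet> h t) - \<rho> * (LBINT t:{0..2*pi}. P t \<bullet> h t) = 0"
    by simp
  \<comment> \<open>Only one factor of \<open>h\<close> is expanded; with \<open>w = h t\<close> the
    left-hand side of \<open>zero\<close> becomes the energy of \<open>h\<close>.\<close>
  have "h t \<bullet> w = m * (g t \<bullet> w) + (- \<rho>) * (P t \<bullet> w)" for t w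
    by (simp add: h_def inner_simps)
  then have "(LBINT t:{0..2*pi}. h t \<bullet> h t) = (LBINT t:{0..2*pi}. m * (g t \<bullet> h t) + (- \<rho>) * (P t \<bullet> h t))"
    by (intro arg_cong[where f = "set_lebesgue_integral lborel {0..2*pi}"] ext)
  also have "\<dots> = (LBINT t:{0..2*pi}. m * (g t \<bullet> h t)) + (LBINT t:{0..2*pi}. (- \<rho>) * (P t \<bullet> h t))"
    by (intro set_integral_add set_integrable_mult_right has_weak_deriv_inner_integrable[OF g h]
        has_weak_deriv_inner_integrable[OF QP h])
  also have "\<dots> = 0"
    unfolding set_integral_mult_right using zero by simp
  finally have energy: "(LBINT t:{0..2*pi}. h t \<bullet> h t) = 0" .
  \<comment> \<open>Zero energy leaves only constants, and every generator passes through the origin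
    at time 0.\<close>
  have "\<delta> 0 = 0" using \<delta> by (simp add: eight_generators_def)
  have on_period: "\<delta> t = 0" if "t \<in> {0..2*pi}" for t
  proof -
    have "\<eta> t $ 0 = \<eta> 0 $ 0" using has_weak_deriv_null_energy[OF h energy that] by simp
    then show ?thesis using \<open>\<delta> 0 = 0\<close> by (simp add: \<eta>_eq)
  qed
  have "\<delta> t = 0" for t
    by (rule periodic_zero_if_zero_on_period[where f = \<delta> and c = "2*pi",
          OF eight_generators_periodic[OF \<delta>] _ on_period]) simp_all
  then have "\<eta> t = 0" for t
    by (simp add: \<eta>_eq config_eq_iff)
  then have "m *\<^sub>R x t = \<rho> *\<^sub>R Q t" for t by (simp add: \<eta>_def)
  with that[of Q P] Q P show thesis by (simp add: x_def)
qed

theorem mainTheorem3: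
  fixes \<alpha> m \<rho> :: real and x :: "real \<Rightarrow> config"
  assumes "0 < \<alpha>" and "\<alpha> < 2" and "0 < m"
    and "x \<in> H_eight" and "collision_free x"
    and "critical_in_H_eight \<alpha> m x"
    and "\<rho> = 2 * kinetic m x / (\<alpha> * potential_integral \<alpha> m x)"
  shows "\<rho> > 0 \<and>
    (\<forall>i. \<exists>a. has_second_deriv (\<lambda>t. x t $ i) a \<and>
       (\<forall>t. m *\<^sub>R a t = \<rho> *\<^sub>R body_gradient \<alpha> m i (x t))) \<and>
    (\<forall>i. \<exists>b. has_second_deriv (\<lambda>s. x (s / sqrt \<rho>) $ i) b \<and>
       (\<forall>s. m *\<^sub>R b s = body_gradient \<alpha> m i (x (s / sqrt \<rho>))))"
proof -
  obtain \<gamma> where \<gamma>: "\<gamma> \<in> eight_generators" and x: "x = choreography \<gamma>"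
    using assms(4) by (auto simp: H_eight_iff)
  have nc: "noncolliding (choreography \<gamma> t)" for t
    using assms(5) by (simp add: collision_free_iff x)
  have \<gamma>H1: "\<gamma> \<in> H1_loops" using \<gamma> by (simp add: eight_generators_iff)
  have "potential_integral \<alpha> m x > 0"
    using assms(3) unfolding x
    by (intro potential_integral_pos nc H1_loops_continuous choreography_H1_loops \<gamma>H1) simp
  moreover have "kinetic m x > 0" unfolding x by (rule kinetic_pos[OF \<gamma>H1 nc assms(3)])
  ultimately have \<rho>: "\<rho> > 0" using assms(1,7) by simp
  obtain Q P where Q: "\<And>t. (Q has_vector_derivative P t) (at t)"
    and P: "\<And>t. (P has_vector_derivative potential_gradient \<alpha> m (x t)) (at t)"
    and eq: "\<And>t. m *\<^sub>R x t = \<rho> *\<^sub>R Q t"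
    using critical_generator_solves[OF assms(1,3) \<gamma> nc assms(6,7)[unfolded x]] unfolding x by metis
  define a where "a i t = (\<rho> / m) *\<^sub>R body_gradient \<alpha> m i (x t)" for i t
  \<comment> \<open>Reading the identity as \<open>x = (\<rho> / m) Q\<close> lifts each body from
    H1 to C2.\<close>
  have xi: "(\<lambda>t. x t $ i) = (\<lambda>t. (\<rho> / m) *\<^sub>R Q t $ i)" for i
  proof
    fix t
    have "x t = (1 / m) *\<^sub>R (m *\<^sub>R x t)" using assms(3) by simp
    also have "\<dots> = (\<rho> / m) *\<^sub>R Q t" unfolding eq by simp
    finally show "x t $ i = (\<rho> / m) *\<^sub>R Q t $ i" by simp
  qed
  have second: "has_second_deriv (\<lambda>t. x t $ i) (a i)" for i
    unfolding has_second_deriv_def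
  proof (intro exI allI conjI)
    note nth = bounded_linear.has_vector_derivative[OF bounded_linear_compose[OF
        bounded_linear_scaleR_right bounded_linear_vec_nth]]
    fix t
    show "((\<lambda>t. x t $ i) has_vector_derivative (\<rho> / m) *\<^sub>R P t $ i) (at t)"
      unfolding xi by (rule nth[OF Q])
    show "((\<lambda>t. (\<rho> / m) *\<^sub>R P t $ i) has_vector_derivative a i t) (at t)"
      unfolding a_def body_gradient_eq[OF nc, folded x] by (rule nth[OF P])
  qed
  \<comment> \<open>The old time is \<open>s / sqrt \<rho>\<close>, so two differentiations in
    \<open>s\<close> produce the factor \<open>1 / \<rho>\<close> that removes \<open>\<rho>\<close>
    from the equation.\<close>
  have "has_second_deriv (\<lambda>s. x (s / sqrt \<rho>) $ i) (\<lambda>s. (1 / \<rho>) *\<^sub>R a i (s / sqrt \<rho>))" for i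
    using has_second_deriv_rescale[OF second[of i], of "1 / sqrt \<rho>"] \<rho> by (simp add: power_divide)
  moreover have "m *\<^sub>R a i t = \<rho> *\<^sub>R body_gradient \<alpha> m i (x t)"
    and "m *\<^sub>R (1 / \<rho>) *\<^sub>R a i t = body_gradient \<alpha> m i (x t)" for i t
    using assms(3) \<rho> by (simp_all add: a_def)
  ultimately show ?thesis using \<rho> second by blast
qed

end
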